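(* Let $X$ be a two-sided shift space on a finite alphabet with language $\mathcal L$, and $\varphi\colon X\to\mathbb R$ a continuous potential. Let $m^{\mathrm u}_x$ and $m^{\mathrm s}_x$ be the families of unstable and stable leaf measures. Then if $Z\subset W^{\mathrm u}_{\mathrm{loc}}(x)$ is a Borel set such that $\sigma(Z)\subset W^{\mathrm u}_{\mathrm{loc}}(\sigma x)$, we have $$m^{\mathrm u}_{\sigma x}(\sigma Z)=\int_Ze^{-\varphi(y)+P}\,dm^{\mathrm u}_x(y).$$ Similarly, given a Borel set $Z\subset W^{\mathrm s}_{\mathrm{loc}}(x)$, we have $$m^{\mathrm s}_{\sigma^{-1}x}(\sigma^{-1}Z)=\int_Ze^{-\varphi(y)+P}\,dm^{\mathrm s}_x(y).$$
   Context: Let $A$ be a finite set and $\sigma\colon A^{\mathbb Z}\to A^{\mathbb Z}$ the shift $(\sigma x)_n=x_{n+1}$; $A^{\mathbb Z}$ has the metric $d(x,y)=2^{-\min\{|n|:x_n\ne y_n\}}$. A two-sided shift space is a closed $\sigma$-invariant set $X\subset A^{\mathbb Z}$. For $w\in A^n$ (length $|w|=n$) let $[w]^+=\{x\in X:x_{[0,n)}=w\}$ and $[w]^-=\{x\in X:x_{(-n,0]}=w\}$; $\mathcal L_n=\{w\in A^n:[w]^+\ne\emptyset\}$, $\mathcal L=\bigcup_{n\ge0}\mathcal L_n$, $\mathcal L_{\ge N}=\{w\in\mathcal L:|w|\ge N\}$. With $S_n\varphi(x)=\sum_{k=0}^{n-1}\varphi(\sigma^kx)$, put $\Phi(w)=\sup_{x\in[w]^+}S_{|w|}\varphi(x)$,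 $\Lambda_n=\sum_{w\in\mathcal L_n}e^{\Phi(w)}$, and $P=\lim_{n\to\infty}\frac1n\log\Lambda_n$ (topological pressure; the limit exists). Leaves, for $x\in X$: $W^{\mathrm u}_{\mathrm{loc}}(x)=\{y\in X:y_k=x_k\ \forall k\le0\}$, $W^{\mathrm s}_{\mathrm{loc}}(x)=\{y\in X:y_k=x_k\ \forall k\ge0\}$. Weights: $\Phi^+_x(w)=\sup\{S_{|w|}\varphi(y):y\in W^{\mathrm u}_{\mathrm{loc}}(x)\cap[w]^+\}$ and $\Phi^-_x(w)=\sup\{\sum_{k=0}^{|w|-1}\varphi(\sigma^{-k}y):y\in W^{\mathrm s}_{\mathrm{loc}}(x)\cap[w]^-\}$, with $\sup\emptyset=-\infty$, $e^{-\infty}=0$. Covers: $\mathbb E^{\pm}(Z,N)=\{\mathcal E\subset\mathcal L_{\ge N}:Z\subset\bigcup_{w\in\mathcal E}[w]^{\pm}\}$. The leaf measures are the Borel measures $m^{\mathrm u}_x$ on $W^{\mathrm u}_{\mathrm{loc}}(x)$ and $m^{\mathrm s}_x$ on $W^{\mathrm s}_{\mathrm{loc}}(x)$ given by $$m^{\mathrm u}_x(Z)=\lim_{N\to\infty}\inf\Big\{\sum_{w\in\mathcal E}e^{\Phi^+_x(w)-|w|P}:\mathcal E\in\mathbb E^+(Z,N)\Big\},$$ $$m^{\mathrm s}_x(Z)=\lim_{N\to\infty}\inf\Big\{\sum_{w\in\mathcal E}e^{\Phi^-_x(w)-|w|P}:\mathcal E\in\mathbb E^-(Z,N)\Big\}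.$$
   Formalization: In the stable half, the hypothesis σ^{-1}(Z) ⊂ W^s_loc(σ^{-1}x) is added, as in the unstable half; without it the left side is undefined, and by the covering formula it fails for the full 2-shift with φ=0 and Z=W^s_loc(x). *)

theory Defs
  imports "HOL-Analysis.Analysis"
begin

definition shift :: "(int \<Rightarrow> 'a) \<Rightarrow> (int \<Rightarrow> 'a)" where
  "shift x = (\<lambda>n. x (n + 1))"

lemma bij_shift: "bij shift"
  by (rule bij_betw_byWitness[where f' = "\<lambda>x n. x (n - 1)"]) (auto simp: shift_def)

lemma inv_shift: "inv shift x = (\<lambda>n. x (n - 1))"
  by (rule inv_f_eq[OF bij_is_inj[OF bij_shift]]) (simp add: shift_def)

definition full_shift :: "'a set \<Rightarrow> (int \<Rightarrow> 'a) set" where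
  "full_shift A = {x. range x \<subseteq> A}"

text \<open>The metric \<open>2 ^ (- min {\<bar>n\<bar> : x n \<noteq> y n})\<close>, with the usual convention \<open>d x x = 0\<close>.\<close>

definition shift_dist :: "(int \<Rightarrow> 'a) \<Rightarrow> (int \<Rightarrow> 'a) \<Rightarrow> real" where
  "shift_dist x y =
     (if x = y then 0 else (1/2) ^ (LEAST k::nat. \<exists>n. \<bar>n\<bar> = int k \<and> x n \<noteq> y n))"

abbreviation shift_topology :: "(int \<Rightarrow> 'a) set \<Rightarrow> (int \<Rightarrow> 'a) topology" where
  "shift_topology M \<equiv> Metric_space.mtopology M shift_dist"

lemma shift_dist_less_iff:
  "shift_dist x y < (1/2) ^ k \<longleftrightarrow> (\<forall>n. \<bar>n\<bar> \<le> int k \<longrightarrow> x n = y n)"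
proof (cases "x = y")
  case False
  let ?P = "\<lambda>k::nat. \<exists>n. \<bar>n\<bar> = int k \<and> x n \<noteq> y n"
  obtain n where n: "x n \<noteq> y n" using False by auto
  hence "?P (nat \<bar>n\<bar>)" by auto
  hence P: "?P (LEAST k. ?P k)" by (rule LeastI)
  have "shift_dist x y < (1/2) ^ k \<longleftrightarrow> k < (LEAST k. ?P k)"
    using False by (simp add: shift_dist_def power_strict_decreasing_iff)
  also have "\<dots> \<longleftrightarrow> (\<forall>n. \<bar>n\<bar> \<le> int k \<longrightarrow> x n = y n)"
  proof
    assume k: "k < (LEAST k. ?P k)"
    show "\<forall>n. \<bar>n\<bar> \<le> int k \<longrightarrow> x n = y n"
    proof (intro allI impI, rule ccontr)
      fix m :: int assume m: "\<bar>m\<bar> \<le> int k" "x m \<noteq> y m"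
      hence "?P (nat \<bar>m\<bar>)" by auto
      hence "(LEAST k. ?P k) \<le> nat \<bar>m\<bar>" by (rule Least_le)
      with k m show False by linarith
    qed
  next
    assume *: "\<forall>n. \<bar>n\<bar> \<le> int k \<longrightarrow> x n = y n"
    obtain m where m: "\<bar>m\<bar> = int (LEAST k. ?P k)" "x m \<noteq> y m" using P by blast
    have "\<not> \<bar>m\<bar> \<le> int k" using *[rule_format, of m] m(2) by blast
    then show "k < (LEAST k. ?P k)" unfolding m(1) by linarith
  qed
  finally show ?thesis .
qed (simp add: shift_dist_def)

lemma Metric_space_shift_dist: "Metric_space M shift_dist"
proof
  show "0 \<le> shift_dist x y" for x y :: "int \<Rightarrow> 'a" by (simp add: shift_dist_def)
  show "shift_dist x y = shift_dist y x" for x y :: "int \<Rightarrow> 'a"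
  proof (cases "x = y")
    case False
    have "(\<lambda>k::nat. \<exists>n. \<bar>n\<bar> = int k \<and> x n \<noteq> y n) = (\<lambda>k. \<exists>n. \<bar>n\<bar> = int k \<and> y n \<noteq> x n)"
      by (intro ext) metis
    with False show ?thesis by (simp add: shift_dist_def)
  qed simp
  show "shift_dist x y = 0 \<longleftrightarrow> x = y" for x y :: "int \<Rightarrow> 'a"
    by (simp add: shift_dist_def)
  show "shift_dist x z \<le> shift_dist x y + shift_dist y z" for x y z :: "int \<Rightarrow> 'a"
  proof (rule ccontr)
    assume *: "\<not> shift_dist x z \<le> shift_dist x y + shift_dist y z"
    have nn: "0 \<le> shift_dist x y" "0 \<le> shift_dist y z" by (simp_all add: shift_dist_def)
    have "shift_dist x z \<noteq> 0" using * nn by linarith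
    then obtain k where k: "shift_dist x z = (1/2) ^ k"
      unfolding shift_dist_def[of x z] by (metis (no_types, lifting))
    have "shift_dist x y < (1/2) ^ k" "shift_dist y z < (1/2) ^ k" using * nn k by linarith+
    hence "shift_dist x z < (1/2) ^ k" unfolding shift_dist_less_iff by simp
    with k show False by simp
  qed
qed

text \<open>
  Invariance is the equality \<open>\<sigma> X = X\<close>, so that \<open>\<sigma>\<^sup>-\<^sup>1\<close> also maps \<open>X\<close> to itself.
\<close>

definition two_sided_shift_space :: "'a set \<Rightarrow> (int \<Rightarrow> 'a) set \<Rightarrow> bool" where
  "two_sided_shift_space A X \<longleftrightarrow>
     finite A \<and> closedin (shift_topology (full_shift A)) X \<and> shift ` X = X"

definition continuous_potential :: "(int \<Rightarrow> 'a) set \<Rightarrow> ((int \<Rightarrow> 'a) \<Rightarrow> real) \<Rightarrow> bool" where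
  "continuous_potential X \<phi> \<longleftrightarrow> continuous_map (shift_topology X) euclideanreal \<phi>"

definition cyl_plus :: "(int \<Rightarrow> 'a) set \<Rightarrow> 'a list \<Rightarrow> (int \<Rightarrow> 'a) set" where
  "cyl_plus X w = {x \<in> X. map x [0..int (length w) - 1] = w}"

definition cyl_minus :: "(int \<Rightarrow> 'a) set \<Rightarrow> 'a list \<Rightarrow> (int \<Rightarrow> 'a) set" where
  "cyl_minus X w = {x \<in> X. map x [1 - int (length w)..0] = w}"

definition language_n :: "(int \<Rightarrow> 'a) set \<Rightarrow> nat \<Rightarrow> 'a list set" where
  "language_n X n = {w. length w = n \<and> cyl_plus X w \<noteq> {}}"

definition language :: "(int \<Rightarrow> 'a) set \<Rightarrow> 'a list set" where
  "language X = (\<Union>n. language_n X n)"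

definition birkhoff_sum :: "((int \<Rightarrow> 'a) \<Rightarrow> real) \<Rightarrow> nat \<Rightarrow> (int \<Rightarrow> 'a) \<Rightarrow> real" where
  "birkhoff_sum \<phi> n x = (\<Sum>k<n. \<phi> ((shift ^^ k) x))"

definition backward_birkhoff_sum :: "((int \<Rightarrow> 'a) \<Rightarrow> real) \<Rightarrow> nat \<Rightarrow> (int \<Rightarrow> 'a) \<Rightarrow> real" where
  "backward_birkhoff_sum \<phi> n x = (\<Sum>k<n. \<phi> ((inv shift ^^ k) x))"

definition word_weight :: "(int \<Rightarrow> 'a) set \<Rightarrow> ((int \<Rightarrow> 'a) \<Rightarrow> real) \<Rightarrow> 'a list \<Rightarrow> real" where
  "word_weight X \<phi> w = (SUP x\<in>cyl_plus X w. birkhoff_sum \<phi> (length w) x)"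

definition partition_sum :: "(int \<Rightarrow> 'a) set \<Rightarrow> ((int \<Rightarrow> 'a) \<Rightarrow> real) \<Rightarrow> nat \<Rightarrow> real" where
  "partition_sum X \<phi> n = (\<Sum>w\<in>language_n X n. exp (word_weight X \<phi> w))"

definition pressure :: "(int \<Rightarrow> 'a) set \<Rightarrow> ((int \<Rightarrow> 'a) \<Rightarrow> real) \<Rightarrow> real" where
  "pressure X \<phi> = lim (\<lambda>n. ln (partition_sum X \<phi> n) / real n)"

definition W_u :: "(int \<Rightarrow> 'a) set \<Rightarrow> (int \<Rightarrow> 'a) \<Rightarrow> (int \<Rightarrow> 'a) set" where
  "W_u X x = {y \<in> X. \<forall>k\<le>0. y k = x k}"

definition W_s :: "(int \<Rightarrow> 'a) set \<Rightarrow> (int \<Rightarrow> 'a) \<Rightarrow> (int \<Rightarrow> 'a) set" where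
  "W_s X x = {y \<in> X. \<forall>k\<ge>0. y k = x k}"

text \<open>Suprema over leaves are taken in \<^typ>\<open>ereal\<close>, where \<open>SUP y\<in>{}. f y = -\<infinity>\<close>.\<close>

definition unstable_weight ::
    "(int \<Rightarrow> 'a) set \<Rightarrow> ((int \<Rightarrow> 'a) \<Rightarrow> real) \<Rightarrow> (int \<Rightarrow> 'a) \<Rightarrow> 'a list \<Rightarrow> ereal" where
  "unstable_weight X \<phi> x w =
     (SUP y\<in>W_u X x \<inter> cyl_plus X w. ereal (birkhoff_sum \<phi> (length w) y))"

definition stable_weight ::
    "(int \<Rightarrow> 'a) set \<Rightarrow> ((int \<Rightarrow> 'a) \<Rightarrow> real) \<Rightarrow> (int \<Rightarrow> 'a) \<Rightarrow> 'a list \<Rightarrow> ereal" where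
  "stable_weight X \<phi> x w =
     (SUP y\<in>W_s X x \<inter> cyl_minus X w. ereal (backward_birkhoff_sum \<phi> (length w) y))"

text \<open>The exponential with \<open>exp (-\<infinity>) = 0\<close>.\<close>

definition exp_ereal :: "ereal \<Rightarrow> ennreal" where
  "exp_ereal t = (case t of ereal r \<Rightarrow> ennreal (exp r) | PInfty \<Rightarrow> \<infinity> | MInfty \<Rightarrow> 0)"

text \<open>
  The two constructions below are shared by the unstable case (\<open>cyl = cyl_plus X\<close>) and the
  stable case (\<open>cyl = cyl_minus X\<close>).  A cover may be an infinite set of words.
\<close>

definition covers ::
    "(int \<Rightarrow> 'a) set \<Rightarrow> ('a list \<Rightarrow> (int \<Rightarrow> 'a) set) \<Rightarrow> (int \<Rightarrow> 'a) set \<Rightarrow> nat \<Rightarrow> 'a list set set" where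
  "covers X cyl Z N = {E. E \<subseteq> {w \<in> language X. N \<le> length w} \<and> Z \<subseteq> (\<Union>w\<in>E. cyl w)}"

definition cover_value ::
    "(int \<Rightarrow> 'a) set \<Rightarrow> ('a list \<Rightarrow> (int \<Rightarrow> 'a) set) \<Rightarrow> ('a list \<Rightarrow> ennreal) \<Rightarrow> (int \<Rightarrow> 'a) set \<Rightarrow> ennreal"
  where
  "cover_value X cyl c Z = lim (\<lambda>N. INF E\<in>covers X cyl Z N. \<Sum>\<^sub>\<infinity>w\<in>E. c w)"

definition unstable_value ::
    "(int \<Rightarrow> 'a) set \<Rightarrow> ((int \<Rightarrow> 'a) \<Rightarrow> real) \<Rightarrow> (int \<Rightarrow> 'a) \<Rightarrow> (int \<Rightarrow> 'a) set \<Rightarrow> ennreal" where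
  "unstable_value X \<phi> x = cover_value X (cyl_plus X)
     (\<lambda>w. exp_ereal (unstable_weight X \<phi> x w - ereal (real (length w) * pressure X \<phi>)))"

definition stable_value ::
    "(int \<Rightarrow> 'a) set \<Rightarrow> ((int \<Rightarrow> 'a) \<Rightarrow> real) \<Rightarrow> (int \<Rightarrow> 'a) \<Rightarrow> (int \<Rightarrow> 'a) set \<Rightarrow> ennreal" where
  "stable_value X \<phi> x = cover_value X (cyl_minus X)
     (\<lambda>w. exp_ereal (stable_weight X \<phi> x w - ereal (real (length w) * pressure X \<phi>)))"

definition borel_subsets :: "(int \<Rightarrow> 'a) set \<Rightarrow> (int \<Rightarrow> 'a) set set" where
  "borel_subsets M = sigma_sets M {U. openin (shift_topology M) U}"

text \<open>
  \<^const>\<open>measure_of\<close> yields the null measure when its third argument is not countably additive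
  on the given sigma-algebra; the lemmas \<open>emeasure_unstable_measure\<close> and
  \<open>emeasure_stable_measure\<close> below show that this does not happen here.
\<close>

definition unstable_measure ::
    "(int \<Rightarrow> 'a) set \<Rightarrow> ((int \<Rightarrow> 'a) \<Rightarrow> real) \<Rightarrow> (int \<Rightarrow> 'a) \<Rightarrow> (int \<Rightarrow> 'a) measure" where
  "unstable_measure X \<phi> x = measure_of (W_u X x) (borel_subsets (W_u X x)) (unstable_value X \<phi> x)"

definition stable_measure ::
    "(int \<Rightarrow> 'a) set \<Rightarrow> ((int \<Rightarrow> 'a) \<Rightarrow> real) \<Rightarrow> (int \<Rightarrow> 'a) \<Rightarrow> (int \<Rightarrow> 'a) measure" where
  "stable_measure X \<phi> x = measure_of (W_s X x) (borel_subsets (W_s X x)) (stable_value X \<phi> x)"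

lemma borel_subsets_Pow: "borel_subsets M \<subseteq> Pow M"
proof -
  interpret Metric_space M shift_dist by (rule Metric_space_shift_dist)
  show ?thesis unfolding borel_subsets_def
    using openin_subset[of mtopology]
    by (metis (no_types, lifting) CollectD Pow_iff sigma_sets_into_sp subsetI topspace_mtopology)
qed

lemma infsum_ennreal_SUP:
  fixes c :: "'b \<Rightarrow> ennreal"
  shows "infsum c E = (SUP F\<in>{F. finite F \<and> F \<subseteq> E}. sum c F)"
  by (rule nonneg_infsum_complete) simp

lemma infsum_ennreal_mono_set:
  fixes c :: "'b \<Rightarrow> ennreal"
  assumes "E \<subseteq> F" shows "infsum c E \<le> infsum c F"
  unfolding infsum_ennreal_SUP using assms by (intro SUP_subset_mono) auto

lemma infsum_ennreal_UN_le:
  fixes c :: "'b \<Rightarrow> ennreal" and E :: "nat \<Rightarrow> 'b set"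
  shows "infsum c (\<Union>i. E i) \<le> (\<Sum>i. infsum c (E i))"
  unfolding infsum_ennreal_SUP[of c "\<Union>i. E i"]
proof (rule SUP_least, clarify)
  fix F assume F: "finite F" "F \<subseteq> (\<Union>i. E i)"
  have "sum c F \<le> (\<Sum>w\<in>F. \<Sum>i. if w \<in> E i then c w else 0)"
  proof (rule sum_mono)
    fix w assume "w \<in> F"
    then obtain i where "w \<in> E i" using F by auto
    then have "c w = (\<Sum>j\<in>{i}. if w \<in> E j then c w else 0)" by simp
    also have "\<dots> \<le> (\<Sum>j. if w \<in> E j then c w else 0)" by (rule sum_le_suminf) auto
    finally show "c w \<le> (\<Sum>j. if w \<in> E j then c w else 0)" .
  qed
  also have "\<dots> = (\<Sum>i. \<Sum>w\<in>F. if w \<in> E i then c w else 0)"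
    by (rule suminf_sum[symmetric]) auto
  also have "\<dots> \<le> (\<Sum>i. infsum c (E i))"
  proof (rule suminf_le)
    fix i
    have "(\<Sum>w\<in>F. if w \<in> E i then c w else 0) = sum c (F \<inter> E i)"
      using F by (simp add: sum.inter_restrict)
    also have "\<dots> \<le> infsum c (E i)"
      unfolding infsum_ennreal_SUP using F by (intro SUP_upper) auto
    finally show "(\<Sum>w\<in>F. if w \<in> E i then c w else 0) \<le> infsum c (E i)" .
  qed auto
  finally show "sum c F \<le> (\<Sum>i. infsum c (E i))" .
qed

lemma cover_value_eq_SUP:
  "cover_value X cyl c Z = (SUP N. INF E\<in>covers X cyl Z N. infsum c E)"
  unfolding cover_value_def
  by (rule limI, rule LIMSEQ_SUP) (auto intro!: incseq_SucI INF_superset_mono simp: covers_def)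

lemma INF_covers_UN_le:
  fixes c :: "'a list \<Rightarrow> ennreal"
  shows "(INF E\<in>covers X cyl (\<Union>i::nat. A i) N. infsum c E)
     \<le> (\<Sum>i. INF E\<in>covers X cyl (A i) N. infsum c E)"
    (is "?m (\<Union>i. A i) \<le> _")
proof (rule ennreal_le_epsilon)
  fix e :: real assume fin: "(\<Sum>i. ?m (A i)) < top" and e: "0 < e"
  have "\<exists>E\<in>covers X cyl (A i) N. infsum c E \<le> ?m (A i) + ennreal (e * (1/2)^Suc i)" for i
  proof -
    have "?m (A i) < top"
      using fin ennreal_suminf_lessD by blast
    moreover have "0 < ennreal (e * (1/2)^Suc i)" using e by simp
    ultimately have "?m (A i) < ?m (A i) + ennreal (e * (1/2)^Suc i)"
      using ennreal_add_left_cancel_less[of "?m (A i)" 0 "ennreal (e * (1/2)^Suc i)"]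
      by (simp only: add_0_right infinity_ennreal_def) (auto simp only: less_irrefl)
    then obtain E where "E \<in> covers X cyl (A i) N"
        "infsum c E < ?m (A i) + ennreal (e * (1/2)^Suc i)"
      unfolding INF_less_iff by blast
    then show ?thesis by (auto intro: less_imp_le)
  qed
  then obtain E where E: "\<And>i. E i \<in> covers X cyl (A i) N"
      "\<And>i. infsum c (E i) \<le> ?m (A i) + ennreal (e * (1/2)^Suc i)" by metis
  have "(\<Union>i. E i) \<in> covers X cyl (\<Union>i. A i) N"
    using E(1) unfolding covers_def by fastforce
  hence "?m (\<Union>i. A i) \<le> infsum c (\<Union>i. E i)" by (rule INF_lower)
  also have "\<dots> \<le> (\<Sum>i. infsum c (E i))" by (rule infsum_ennreal_UN_le)
  also have "\<dots> \<le> (\<Sum>i. ?m (A i) + ennreal (e * (1/2)^Suc i))"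
    by (rule suminf_le[OF E(2)]) auto
  also have "\<dots> = (\<Sum>i. ?m (A i)) + (\<Sum>i. ennreal (e * (1/2)^Suc i))"
    by (rule suminf_add[symmetric]) auto
  also have "(\<Sum>i. ennreal (e * (1/2)^Suc i)) = ennreal e"
  proof -
    have "(\<lambda>i. e * (1/2)^Suc i) sums (e * 1)"
      by (rule sums_mult[OF power_half_series])
    then show ?thesis using e
      by (subst suminf_ennreal_eq[where x = e]) auto
  qed
  finally show "?m (\<Union>i. A i) \<le> (\<Sum>i. ?m (A i)) + ennreal e" .
qed

lemma outer_measure_space_cover_value:
  "outer_measure_space (Pow W) (cover_value X cyl c)"
  unfolding outer_measure_space_def
proof (intro conjI)
  have "{} \<in> covers X cyl {} N" for N by (auto simp: covers_def)
  hence "(INF E\<in>covers X cyl {} N. infsum c E) \<le> infsum c {}" for N by (rule INF_lower)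
  then show "positive (Pow W) (cover_value X cyl c)"
    unfolding positive_def cover_value_eq_SUP by simp
  show "increasing (Pow W) (cover_value X cyl c)"
    unfolding increasing_def cover_value_eq_SUP
    by (auto intro!: SUP_mono' INF_superset_mono simp: covers_def)
  show "countably_subadditive (Pow W) (cover_value X cyl c)"
    unfolding countably_subadditive_def
  proof (intro allI impI)
    fix A :: "nat \<Rightarrow> (int \<Rightarrow> 'a) set"
    show "cover_value X cyl c (\<Union>i. A i) \<le> (\<Sum>i. cover_value X cyl c (A i))"
      unfolding cover_value_eq_SUP[of _ _ _ "\<Union>i. A i"]
    proof (rule SUP_least)
      fix N
      have "(INF E\<in>covers X cyl (\<Union>i. A i) N. infsum c E)
          \<le> (\<Sum>i. INF E\<in>covers X cyl (A i) N. infsum c E)" by (rule INF_covers_UN_le)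
      also have "\<dots> \<le> (\<Sum>i. cover_value X cyl c (A i))"
        unfolding cover_value_eq_SUP by (intro suminf_le) (auto intro: SUP_upper)
      finally show "(INF E\<in>covers X cyl (\<Union>i. A i) N. infsum c E)
          \<le> (\<Sum>i. cover_value X cyl c (A i))" .
    qed
  qed
qed

lemma cover_value_cyl_split:
  assumes nested: "\<And>v w. length v \<le> length w \<Longrightarrow> cyl w \<subseteq> cyl v \<or> cyl w \<inter> cyl v = {}"
  shows "cover_value X cyl c (Z \<inter> cyl v) + cover_value X cyl c (Z - cyl v) \<le> cover_value X cyl c Z"
proof -
  let ?m = "\<lambda>Z N. INF E\<in>covers X cyl Z N. infsum c E"
  have mono: "incseq (?m Z)" for Z
    by (auto intro!: incseq_SucI INF_superset_mono simp: covers_def)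
  have "?m (Z \<inter> cyl v) N + ?m (Z - cyl v) N \<le> cover_value X cyl c Z" for N
  proof -
    let ?N = "max N (length v)"
    have "?m (Z \<inter> cyl v) N + ?m (Z - cyl v) N \<le> ?m Z ?N"
    proof (rule INF_greatest)
      fix E assume E: "E \<in> covers X cyl Z ?N"
      define E1 where "E1 = {w \<in> E. cyl w \<subseteq> cyl v}"
      have "E1 \<in> covers X cyl (Z \<inter> cyl v) N"
        using E nested[of v] unfolding covers_def E1_def by fastforce
      moreover have "E - E1 \<in> covers X cyl (Z - cyl v) N"
        using E unfolding covers_def E1_def by fastforce
      ultimately have "?m (Z \<inter> cyl v) N + ?m (Z - cyl v) N \<le> infsum c E1 + infsum c (E - E1)"
        by (intro add_mono INF_lower)
      also have "\<dots> = infsum c (E1 \<union> (E - E1))"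
        by (rule infsum_Un_disjoint[symmetric]) (auto intro!: nonneg_summable_on_complete)
      also have "E1 \<union> (E - E1) = E" by (auto simp: E1_def)
      finally show "?m (Z \<inter> cyl v) N + ?m (Z - cyl v) N \<le> infsum c E" .
    qed
    also have "\<dots> \<le> cover_value X cyl c Z"
      unfolding cover_value_eq_SUP by (rule SUP_upper) simp
    finally show ?thesis .
  qed
  then show ?thesis
    unfolding cover_value_eq_SUP[of X cyl c "Z \<inter> cyl v"] cover_value_eq_SUP[of X cyl c "Z - cyl v"]
    by (subst ennreal_SUP_add[OF mono mono, symmetric]) (rule SUP_least)
qed

lemma measure_space_subset_aux:
  assumes "measure_space W L f" "B \<subseteq> L" "sigma_algebra W B"
  shows "measure_space W B f"
proof -
  have "countably_additive B f"
    unfolding countably_additive_def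
  proof (intro allI impI)
    fix A :: "nat \<Rightarrow> _"
    assume A: "range A \<subseteq> B" "disjoint_family A" "(\<Union>i. A i) \<in> B"
    have ca: "countably_additive L f" using assms(1) by (simp add: measure_space_def)
    show "(\<Sum>i. f (A i)) = f (\<Union>i. A i)"
      by (rule ca[unfolded countably_additive_def, rule_format]) (use A assms(2) in auto)
  qed
  moreover have "positive B f" using assms(1) by (simp add: measure_space_def positive_def)
  ultimately show ?thesis using assms(3) by (simp add: measure_space_def)
qed

lemma measure_space_cover_value:
  assumes nested: "\<And>v w. length v \<le> length w \<Longrightarrow> cyl w \<subseteq> cyl v \<or> cyl w \<inter> cyl v = {}"
    and small: "\<And>y k. y \<in> W \<Longrightarrow> \<exists>v\<in>V. y \<in> cyl v \<and> (\<forall>z\<in>W \<inter> cyl v. \<forall>n. \<bar>n\<bar> \<le> int k \<longrightarrow> y n = z n)"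
    and V: "countable V"
  shows "measure_space W (borel_subsets W) (cover_value X cyl c)"
proof -
  let ?f = "cover_value X cyl c" and ?L = "lambda_system W (Pow W) (cover_value X cyl c)"
  interpret Metric_space W shift_dist by (rule Metric_space_shift_dist)
  interpret P: sigma_algebra W "Pow W" by (rule sigma_algebra_Pow)
  note oms = outer_measure_space_cover_value[of W X cyl c]
  have ms: "measure_space W ?L ?f" by (rule P.caratheodory_lemma[OF oms])
  interpret L: sigma_algebra W ?L using ms by (simp add: measure_space_def)
  have sub: "subadditive (Pow W) ?f"
    using oms P.countably_subadditive_subadditive by (auto simp: outer_measure_space_def)
  have cyl_L: "W \<inter> cyl v \<in> ?L" for v
    unfolding lambda_system_def
  proof (intro CollectI conjI ballI)
    fix Z assume Z: "Z \<in> Pow W"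
    have 1: "W \<inter> cyl v \<inter> Z = Z \<inter> cyl v" "(W - W \<inter> cyl v) \<inter> Z = Z - cyl v" using Z by auto
    have "?f ((Z \<inter> cyl v) \<union> (Z - cyl v)) \<le> ?f (Z \<inter> cyl v) + ?f (Z - cyl v)"
      using Z by (intro subadditiveD[OF sub]) auto
    also have "(Z \<inter> cyl v) \<union> (Z - cyl v) = Z" by auto
    finally show "?f (W \<inter> cyl v \<inter> Z) + ?f ((W - W \<inter> cyl v) \<inter> Z) = ?f Z"
      unfolding 1 using cover_value_cyl_split[of cyl X c Z v, OF nested] by (simp add: antisym)
  qed auto
  have "U \<in> ?L" if U: "openin mtopology U" for U
  proof -
    have "U = (\<Union>v\<in>{v \<in> V. W \<inter> cyl v \<subseteq> U}. W \<inter> cyl v)"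
    proof (intro subset_antisym subsetI)
      fix y assume y: "y \<in> U"
      then obtain r where r: "r > 0" "mball y r \<subseteq> U" and yW: "y \<in> W"
        using U unfolding openin_mtopology by blast
      obtain k where k: "(1/2::real) ^ k < r" using real_arch_pow_inv[of r "1/2"] r by auto
      obtain v where v: "v \<in> V" "y \<in> cyl v"
          "\<forall>z\<in>W \<inter> cyl v. \<forall>n. \<bar>n\<bar> \<le> int k \<longrightarrow> y n = z n" using small[OF yW] by blast
      have "W \<inter> cyl v \<subseteq> U"
      proof
        fix z assume z: "z \<in> W \<inter> cyl v"
        with v(3) have "shift_dist y z < (1/2) ^ k" unfolding shift_dist_less_iff by blast
        with z k yW have "z \<in> mball y r" by simp
        then show "z \<in> U" using r by blast
      qed
      with v yW show "y \<in> (\<Union>v\<in>{v \<in> V. W \<inter> cyl v \<subseteq> U}. W \<inter> cyl v)" by blast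
    qed blast
    moreover have "(\<Union>v\<in>{v \<in> V. W \<inter> cyl v \<subseteq> U}. W \<inter> cyl v) \<in> ?L"
    proof (rule L.countable_UN')
      show "countable {v \<in> V. W \<inter> cyl v \<subseteq> U}" by (rule countable_subset[OF _ V]) blast
      show "(\<lambda>v. W \<inter> cyl v) ` {v \<in> V. W \<inter> cyl v \<subseteq> U} \<subseteq> ?L" using cyl_L by blast
    qed
    ultimately show ?thesis by simp
  qed
  hence "borel_subsets W \<subseteq> ?L"
    unfolding borel_subsets_def by (intro L.sigma_sets_subset) auto
  moreover have "sigma_algebra W (borel_subsets W)"
    unfolding borel_subsets_def using openin_subset[of mtopology]
    by (intro sigma_algebra_sigma_sets) auto
  ultimately show ?thesis by (rule measure_space_subset_aux[OF ms])
qed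

lemma map_upto_eq_iff:
  "map x [a..a + int (length w) - 1] = w \<longleftrightarrow> (\<forall>i<length w. x (a + int i) = w ! i)"
proof -
  have "length [a..a + int (length w) - 1] = length w" by simp
  moreover have "[a..a + int (length w) - 1] ! i = a + int i" if "i < length w" for i
    using that by (intro nth_upto) linarith
  ultimately show ?thesis
    unfolding list_eq_iff_nth_eq[of _ w] length_map by (metis nth_map)
qed

lemma cyl_plus_iff: "x \<in> cyl_plus X w \<longleftrightarrow> x \<in> X \<and> (\<forall>i<length w. x (int i) = w ! i)"
  using map_upto_eq_iff[of x 0 w] unfolding cyl_plus_def add_0 by blast

lemma cyl_minus_iff:
  "x \<in> cyl_minus X w \<longleftrightarrow> x \<in> X \<and> (\<forall>i<length w. x (- int i) = w ! (length w - 1 - i))"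
proof -
  have "(\<forall>i<length w. x (1 - int (length w) + int i) = w ! i) \<longleftrightarrow>
        (\<forall>i<length w. x (- int i) = w ! (length w - 1 - i))" (is "?l \<longleftrightarrow> ?r")
  proof
    assume l: ?l
    show ?r
    proof (intro allI impI)
      fix i assume i: "i < length w"
      have "1 - int (length w) + int (length w - 1 - i) = - int i" using i by simp
      with l[rule_format, of "length w - 1 - i"] i show "x (- int i) = w ! (length w - 1 - i)" by simp
    qed
  next
    assume r: ?r
    show ?l
    proof (intro allI impI)
      fix i assume i: "i < length w"
      have "- int (length w - 1 - i) = 1 - int (length w) + int i"
        and "length w - 1 - (length w - 1 - i) = i" using i by simp_all
      with r[rule_format, of "length w - 1 - i"] i
      show "x (1 - int (length w) + int i) = w ! i" by (simp only:)
    qed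
  qed
  then show ?thesis using map_upto_eq_iff[of x "1 - int (length w)" w] by (simp add: cyl_minus_def)
qed

lemma cyl_plus_nested:
  assumes "length v \<le> length w"
  shows "cyl_plus X w \<subseteq> cyl_plus X v \<or> cyl_plus X w \<inter> cyl_plus X v = {}"
proof (rule disjCI)
  assume "cyl_plus X w \<inter> cyl_plus X v \<noteq> {}"
  then obtain y where "y \<in> cyl_plus X w" "y \<in> cyl_plus X v" by auto
  with assms show "cyl_plus X w \<subseteq> cyl_plus X v" by (auto simp: cyl_plus_iff)
qed

lemma cyl_minus_nested:
  assumes "length v \<le> length w"
  shows "cyl_minus X w \<subseteq> cyl_minus X v \<or> cyl_minus X w \<inter> cyl_minus X v = {}"
proof (rule disjCI)
  assume "cyl_minus X w \<inter> cyl_minus X v \<noteq> {}"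
  then obtain y where y: "y \<in> cyl_minus X w" "y \<in> cyl_minus X v" by auto
  show "cyl_minus X w \<subseteq> cyl_minus X v"
  proof
    fix z assume z: "z \<in> cyl_minus X w"
    have "z (- int i) = v ! (length v - 1 - i)" if "i < length v" for i
    proof -
      have "i < length w" using that assms by simp
      with y z have "z (- int i) = y (- int i)" by (simp add: cyl_minus_iff)
      with y(2) that show ?thesis by (simp add: cyl_minus_iff)
    qed
    with z show "z \<in> cyl_minus X v" by (simp add: cyl_minus_iff)
  qed
qed

lemma shift_space_alphabet:
  assumes "two_sided_shift_space A X" "x \<in> X"
  shows "x n \<in> A"
proof -
  have "X \<subseteq> full_shift A"
    using assms closedin_subset[of "shift_topology (full_shift A)" X]
      Metric_space.topspace_mtopology[OF Metric_space_shift_dist]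
    by (auto simp: two_sided_shift_space_def)
  with assms show ?thesis by (auto simp: full_shift_def)
qed

lemma emeasure_unstable_measure:
  assumes X: "two_sided_shift_space A X" and Z: "Z \<in> borel_subsets (W_u X x)"
  shows "emeasure (unstable_measure X \<phi> x) Z = unstable_value X \<phi> x Z"
proof -
  let ?c = "\<lambda>w. exp_ereal (unstable_weight X \<phi> x w - ereal (real (length w) * pressure X \<phi>))"
  have "measure_space (W_u X x) (borel_subsets (W_u X x)) (cover_value X (cyl_plus X) ?c)"
  proof (rule measure_space_cover_value[where V = "lists A" and cyl = "cyl_plus X"])
    show "cyl_plus X w \<subseteq> cyl_plus X v \<or> cyl_plus X w \<inter> cyl_plus X v = {}"
      if "length v \<le> length w" for v w using that by (rule cyl_plus_nested)
    show "countable (lists A)"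
      using X by (intro countable_lists countable_finite) (simp add: two_sided_shift_space_def)
    fix y k assume y: "y \<in> W_u X x"
    hence yX: "y \<in> X" by (simp add: W_u_def)
    define v where "v = map y [0..int k]"
    have "v \<in> lists A" using shift_space_alphabet[OF X yX] by (auto simp: v_def)
    moreover have "y \<in> cyl_plus X v" using yX by (simp add: v_def cyl_plus_def)
    moreover have "y n = z n" if z: "z \<in> W_u X x \<inter> cyl_plus X v" and n: "\<bar>n\<bar> \<le> int k" for z n
    proof (cases "n \<le> 0")
      case True
      then show ?thesis using y z by (simp add: W_u_def)
    next
      case False
      have l: "nat n < length v" using n False by (simp add: v_def)
      have "z (int (nat n)) = y (int (nat n))"
        using z \<open>y \<in> cyl_plus X v\<close> l unfolding cyl_plus_iff Int_iff by metis
      then show ?thesis using False by simp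
    qed
    ultimately show "\<exists>v\<in>lists A. y \<in> cyl_plus X v \<and>
        (\<forall>z\<in>W_u X x \<inter> cyl_plus X v. \<forall>n. \<bar>n\<bar> \<le> int k \<longrightarrow> y n = z n)" by blast
  qed
  then have ms: "measure_space (W_u X x) (borel_subsets (W_u X x)) (unstable_value X \<phi> x)"
    unfolding unstable_value_def .
  then show ?thesis unfolding unstable_measure_def
    using emeasure_measure_of_sigma[of "W_u X x" "borel_subsets (W_u X x)" "unstable_value X \<phi> x"] Z
    by (simp add: measure_space_def)
qed

lemma emeasure_stable_measure:
  assumes X: "two_sided_shift_space A X" and Z: "Z \<in> borel_subsets (W_s X x)"
  shows "emeasure (stable_measure X \<phi> x) Z = stable_value X \<phi> x Z"
proof -
  let ?c = "\<lambda>w. exp_ereal (stable_weight X \<phi> x w - ereal (real (length w) * pressure X \<phi>))"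
  have "measure_space (W_s X x) (borel_subsets (W_s X x)) (cover_value X (cyl_minus X) ?c)"
  proof (rule measure_space_cover_value[where V = "lists A" and cyl = "cyl_minus X"])
    show "cyl_minus X w \<subseteq> cyl_minus X v \<or> cyl_minus X w \<inter> cyl_minus X v = {}"
      if "length v \<le> length w" for v w using that by (rule cyl_minus_nested)
    show "countable (lists A)"
      using X by (intro countable_lists countable_finite) (simp add: two_sided_shift_space_def)
    fix y k assume y: "y \<in> W_s X x"
    hence yX: "y \<in> X" by (simp add: W_s_def)
    define v where "v = map y [- int k..0]"
    have "v \<in> lists A" using shift_space_alphabet[OF X yX] by (auto simp: v_def)
    moreover have yv: "y \<in> cyl_minus X v" using yX by (simp add: v_def cyl_minus_def)
    moreover have "y n = z n" if z: "z \<in> W_s X x \<inter> cyl_minus X v" and n: "\<bar>n\<bar> \<le> int k" for z n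
    proof (cases "n \<ge> 0")
      case True
      then show ?thesis using y z by (simp add: W_s_def)
    next
      case False
      have l: "nat (- n) < length v" using n False by (simp add: v_def)
      have "z (- int (nat (- n))) = y (- int (nat (- n)))"
        using z yv l unfolding cyl_minus_iff Int_iff by metis
      then show ?thesis using False by simp
    qed
    ultimately show "\<exists>v\<in>lists A. y \<in> cyl_minus X v \<and>
        (\<forall>z\<in>W_s X x \<inter> cyl_minus X v. \<forall>n. \<bar>n\<bar> \<le> int k \<longrightarrow> y n = z n)" by blast
  qed
  then have ms: "measure_space (W_s X x) (borel_subsets (W_s X x)) (stable_value X \<phi> x)"
    unfolding stable_value_def .
  then show ?thesis unfolding stable_measure_def
    using emeasure_measure_of_sigma[of "W_s X x" "borel_subsets (W_s X x)" "stable_value X \<phi> x"] Z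
    by (simp add: measure_space_def)
qed

end

theory Submission
  imports Defs
begin

text \<open>
  The bijection \<open>v \<mapsto> x\<^sub>0v\<close> turns a cover of \<open>\<sigma>Z\<close> into a cover of \<open>Z\<close> and changes the weight
  of a word by the factor \<open>e\<^bsup>\<phi>(y) - P\<^esup>\<close>, up to the oscillation of \<open>\<phi>\<close> on its cylinder.  Hence on
  subsets of a cylinder \<open>[u]\<close> on which \<open>\<phi>\<close> takes values in \<open>[a, b]\<close>, the measures
  \<open>B \<mapsto> m(\<sigma>B)\<close> and \<open>B \<mapsto> \<integral>\<^sub>B e\<^bsup>P - \<phi>\<^esup> dm\<close> agree up to a factor \<open>e\<^bsup>b - a\<^esup>\<close>.  Countably many such
  cylinders cover the leaf, so the two measures agree up to any factor \<open>q > 1\<close>.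
  The stable case is the same argument with \<open>\<sigma>\<^sup>-\<^sup>1\<close> and \<open>v \<mapsto> vx\<^sub>0\<close>.
\<close>

section \<open>Topology of the shift in terms of coordinate windows\<close>

abbreviation agree :: "nat \<Rightarrow> (int \<Rightarrow> 'a) \<Rightarrow> (int \<Rightarrow> 'a) \<Rightarrow> bool" where
  "agree k y z \<equiv> \<forall>n. \<bar>n\<bar> \<le> int k \<longrightarrow> y n = z n"

text \<open>By \<open>shift_dist_less_iff\<close>, the ball of radius \<open>(1/2) ^ k\<close>
  around \<open>y\<close> consists of the points that agree with \<open>y\<close> on
  \<open>[-k, k]\<close>, and every positive radius exceeds some \<open>(1/2) ^ k\<close>. All later
  topological arguments use windows in place of radii.\<close>

lemma openin_shift_topology_iff:
  "openin (shift_topology M) U \<longleftrightarrow> U \<subseteq> M \<and> (\<forall>y\<in>U. \<exists>k. \<forall>z\<in>M. agree k y z \<longrightarrow> z \<in> U)"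
proof -
  interpret Metric_space M shift_dist by (rule Metric_space_shift_dist)
  have "(\<exists>r>0. mball y r \<subseteq> U) \<longleftrightarrow> (\<exists>k. \<forall>z\<in>M. agree k y z \<longrightarrow> z \<in> U)" if y: "y \<in> M" for y
  proof
    assume "\<exists>r>0. mball y r \<subseteq> U"
    then obtain r where r: "r > 0" "mball y r \<subseteq> U" by blast
    obtain k where k: "(1/2::real) ^ k < r" using real_arch_pow_inv[of r "1/2"] r by auto
    have "z \<in> U" if z: "z \<in> M" "agree k y z" for z
    proof -
      have "shift_dist y z < (1/2) ^ k" unfolding shift_dist_less_iff by (rule z(2))
      with k y z(1) have "z \<in> mball y r" by simp
      then show ?thesis using r by blast
    qed
    then show "\<exists>k. \<forall>z\<in>M. agree k y z \<longrightarrow> z \<in> U" by blast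
  next
    assume "\<exists>k. \<forall>z\<in>M. agree k y z \<longrightarrow> z \<in> U"
    then obtain k where k: "\<And>z. z \<in> M \<Longrightarrow> agree k y z \<Longrightarrow> z \<in> U" by blast
    have "mball y ((1/2) ^ k) \<subseteq> U"
      using k shift_dist_less_iff[of y _ k] by auto
    then show "\<exists>r>0. mball y r \<subseteq> U" by (intro exI[of _ "(1/2) ^ k"]) simp
  qed
  then show ?thesis unfolding openin_mtopology by blast
qed

lemma borel_subsets_openI:
  assumes "U \<subseteq> M" "\<And>y. y \<in> U \<Longrightarrow> \<exists>k. \<forall>z\<in>M. agree k y z \<longrightarrow> z \<in> U"
  shows "U \<in> borel_subsets M"
  unfolding borel_subsets_def using assms
  by (intro sigma_sets.Basic) (auto simp: openin_shift_topology_iff)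

lemma continuous_potential_agree:
  assumes "continuous_potential X \<phi>" "y \<in> X" "e > 0"
  shows "\<exists>k. \<forall>z\<in>X. agree k y z \<longrightarrow> \<bar>\<phi> z - \<phi> y\<bar> < e"
proof -
  interpret Metric_space X shift_dist by (rule Metric_space_shift_dist)
  have "openin mtopology {z \<in> topspace mtopology. \<phi> z \<in> ball (\<phi> y) e}"
    using assms(1) unfolding continuous_potential_def
    by (rule openin_continuous_map_preimage) simp
  moreover have "y \<in> {z \<in> topspace mtopology. \<phi> z \<in> ball (\<phi> y) e}"
    using assms by simp
  ultimately obtain k where
    "\<forall>z\<in>X. agree k y z \<longrightarrow> z \<in> {z \<in> topspace mtopology. \<phi> z \<in> ball (\<phi> y) e}"
    unfolding openin_shift_topology_iff by blast
  then show ?thesis by (intro exI[of _ k]) (auto simp: dist_real_def abs_minus_commute)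
qed

section \<open>Transport of covers\<close>

text \<open>Different words of a cover may have the same image under \<open>f\<close>. Choosing one
  preimage for each image gives \<open>E0\<close>, on which \<open>f\<close> is injective, and
  dropping the other nonnegative terms only lowers the sum.\<close>

lemma infsum_ennreal_image_le:
  fixes c :: "'b \<Rightarrow> ennreal"
  shows "infsum c (f ` E) \<le> infsum (\<lambda>w. c (f w)) E"
proof -
  obtain E0 where E0: "E0 \<subseteq> E" "inj_on f E0" "f ` E = f ` E0"
    using subset_image_inj[of "f ` E" f E] by blast
  have "infsum c (f ` E) = infsum (c \<circ> f) E0"
    using infsum_reindex[OF E0(2), of c] E0(3) by simp
  also have "\<dots> \<le> infsum (\<lambda>w. c (f w)) E"
    unfolding o_def by (rule infsum_ennreal_mono_set[OF E0(1)])
  finally show ?thesis .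
qed

lemma infsum_ennreal_cmult_le:
  fixes c :: "'b \<Rightarrow> ennreal"
  shows "infsum (\<lambda>w. K * c w) E \<le> K * infsum c E"
  unfolding infsum_ennreal_SUP[of "\<lambda>w. K * c w"]
proof (rule SUP_least, clarify)
  fix F assume "finite F" "F \<subseteq> E"
  then show "(\<Sum>w\<in>F. K * c w) \<le> K * infsum c E"
    unfolding infsum_ennreal_SUP sum_distrib_left[symmetric]
    by (intro mult_left_mono SUP_upper) auto
qed

lemma infsum_ennreal_mono:
  fixes c d :: "'b \<Rightarrow> ennreal"
  assumes "\<And>w. w \<in> E \<Longrightarrow> c w \<le> d w"
  shows "infsum c E \<le> infsum d E"
  using assms by (intro infsum_mono nonneg_summable_on_complete) auto

lemma cover_value_image_le:
  assumes "0 < k"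
  assumes f: "\<And>w y. y \<in> Z \<Longrightarrow> y \<in> cyl w \<Longrightarrow> w \<in> language X \<Longrightarrow> N0 \<le> length w \<Longrightarrow>
      f w \<in> language X \<and> length w \<le> Suc (length (f w)) \<and> T y \<in> cyl (f w) \<and> c' (f w) \<le> ennreal k * c w"
  shows "cover_value X cyl c' (T ` Z) \<le> ennreal k * cover_value X cyl c Z"
proof -
  let ?K = "ennreal k"
  have inv: "?K * ennreal (1 / k) = 1" "ennreal (1 / k) * ?K = 1"
    using \<open>0 < k\<close> by (simp_all flip: ennreal_mult)
  let ?m = "\<lambda>c Z N. INF E\<in>covers X cyl Z N. infsum c E"
  have "?m c' (T ` Z) N \<le> ?K * cover_value X cyl c Z" for N
  proof -
    \<comment> \<open>The successor makes up for the letter that \<open>f\<close> may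
      remove.\<close>
    let ?N = "max N0 (Suc N)"
    have "?m c' (T ` Z) N \<le> ?K * infsum c E" if E: "E \<in> covers X cyl Z ?N" for E
    proof -
      \<comment> \<open>Nothing is known about \<open>f w\<close> when \<open>cyl w\<close> misses
        \<open>Z\<close>, so such words are discarded before \<open>f\<close> is applied.\<close>
      define E1 where "E1 = {w \<in> E. \<exists>y\<in>Z. y \<in> cyl w}"
      have EE: "w \<in> language X \<and> ?N \<le> length w" if "w \<in> E" for w
        using E that unfolding covers_def by blast
      have 1: "f w \<in> language X \<and> N \<le> length (f w) \<and> c' (f w) \<le> ?K * c w" if "w \<in> E1" for w
      proof -
        obtain y where "y \<in> Z" "y \<in> cyl w" "w \<in> E" using \<open>w \<in> E1\<close> by (auto simp: E1_def)
        with f[of y w] EE[of w] show ?thesis by auto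
      qed
      have "T ` Z \<subseteq> (\<Union>w\<in>f ` E1. cyl w)"
      proof clarify
        fix y assume y: "y \<in> Z"
        then obtain w where w: "w \<in> E" "y \<in> cyl w" using E unfolding covers_def by blast
        with y f[of y w] EE[of w] have "T y \<in> cyl (f w)" by auto
        moreover have "w \<in> E1" using w y by (auto simp: E1_def)
        ultimately show "T y \<in> (\<Union>w\<in>f ` E1. cyl w)" by blast
      qed
      then have "f ` E1 \<in> covers X cyl (T ` Z) N" using 1 by (auto simp: covers_def)
      then have "?m c' (T ` Z) N \<le> infsum c' (f ` E1)" by (rule INF_lower)
      also have "\<dots> \<le> infsum (\<lambda>w. c' (f w)) E1" by (rule infsum_ennreal_image_le)
      also have "\<dots> \<le> infsum (\<lambda>w. ?K * c w) E1" using 1 by (intro infsum_ennreal_mono) auto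
      also have "\<dots> \<le> infsum (\<lambda>w. ?K * c w) E"
        by (rule infsum_ennreal_mono_set) (auto simp: E1_def)
      also have "\<dots> \<le> ?K * infsum c E" by (rule infsum_ennreal_cmult_le)
      finally show ?thesis .
    qed
    \<comment> \<open>To pass to the infimum over \<open>E\<close>, the constant is moved to the
      left by multiplying with \<open>1 / k\<close>, and moved back afterwards.\<close>
    then have "ennreal (1 / k) * ?m c' (T ` Z) N \<le> ennreal (1 / k) * (?K * infsum c E)"
        if "E \<in> covers X cyl Z ?N" for E using that by (intro mult_left_mono) auto
    then have "ennreal (1 / k) * ?m c' (T ` Z) N \<le> ?m c Z ?N"
      by (intro INF_greatest) (simp only: mult.assoc[symmetric] inv(2) mult_1)
    then have "?K * (ennreal (1 / k) * ?m c' (T ` Z) N) \<le> ?K * ?m c Z ?N"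
      by (rule mult_left_mono) simp
    then have "?m c' (T ` Z) N \<le> ?K * ?m c Z ?N"
      by (simp only: mult.assoc[symmetric] inv(1) mult_1)
    also have "\<dots> \<le> ?K * cover_value X cyl c Z"
      unfolding cover_value_eq_SUP by (intro mult_left_mono SUP_upper) auto
    finally show ?thesis .
  qed
  then show ?thesis unfolding cover_value_eq_SUP[of _ _ c'] by (rule SUP_least)
qed

section \<open>Exponentials of suprema\<close>

lemma exp_ereal_mono: "s \<le> t \<Longrightarrow> exp_ereal s \<le> exp_ereal t"
  by (cases s; cases t) (auto simp: exp_ereal_def)

lemma exp_ereal_add: "exp_ereal (ereal a + t) = ennreal (exp a) * exp_ereal t"
  by (cases t) (auto simp: exp_ereal_def exp_add ennreal_mult ennreal_mult_top)

text \<open>Each value over \<open>A\<close> is dominated by a shifted value over \<open>B\<close>,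
  hence so is the supremum. Working in \<open>ereal\<close> includes empty \<open>A\<close>, where
  the left side is 0. The constants \<open>p\<close> and \<open>q\<close> stand for the terms
  \<open>|w| P\<close> of two words of different length.\<close>

lemma exp_ereal_SUP_le:
  fixes f :: "'b \<Rightarrow> real" and h :: "'c \<Rightarrow> real"
  assumes "\<And>y. y \<in> A \<Longrightarrow> \<exists>z\<in>B. f y - p \<le> a + (h z - q)"
  shows "exp_ereal ((SUP y\<in>A. ereal (f y)) - ereal p) \<le>
    ennreal (exp a) * exp_ereal ((SUP z\<in>B. ereal (h z)) - ereal q)"
proof -
  let ?s = "SUP z\<in>B. ereal (h z)"
  have "(SUP y\<in>A. ereal (f y)) \<le> ereal (a + p - q) + ?s"
  proof (rule SUP_least)
    fix y assume "y \<in> A"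
    then obtain z where z: "z \<in> B" "f y - p \<le> a + (h z - q)" using assms by blast
    then have "ereal (f y) \<le> ereal (a + p - q) + ereal (h z)" by simp
    also have "\<dots> \<le> ereal (a + p - q) + ?s" using z by (intro add_left_mono SUP_upper)
    finally show "ereal (f y) \<le> ereal (a + p - q) + ?s" .
  qed
  then have "(SUP y\<in>A. ereal (f y)) - ereal p \<le> (ereal (a + p - q) + ?s) - ereal p"
    by (rule ereal_minus_mono) simp
  also have "\<dots> = ereal a + (?s - ereal q)"
    by (cases ?s) auto
  finally show ?thesis unfolding exp_ereal_add[symmetric] by (rule exp_ereal_mono)
qed

section \<open>From local to global comparison of measures\<close>

text \<open>Disjointing the \<open>C i\<close> cuts \<open>Z\<close> into countably many measurable
  pieces, each inside one \<open>C i\<close>. The local inequalities are then summed using countable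
  additivity of both \<open>N\<close> and \<open>L\<close>.\<close>

lemma emeasure_le_by_countable_cover:
  fixes q :: ennreal
  assumes N: "sets N = sets M" and L: "sets L = sets M"
    and I: "countable I" and C: "\<And>i. i \<in> I \<Longrightarrow> C i \<in> sets M"
    and Z: "Z \<in> sets M" "Z \<subseteq> (\<Union>i\<in>I. C i)"
    and le: "\<And>i B. i \<in> I \<Longrightarrow> B \<in> sets M \<Longrightarrow> B \<subseteq> Z \<inter> C i \<Longrightarrow> emeasure N B \<le> q * emeasure L B"
  shows "emeasure N Z \<le> q * emeasure L Z"
proof (cases "I = {}")
  \<comment> \<open>An empty \<open>I\<close> has no enumeration by \<open>from_nat_into\<close>,
    but then \<open>Z\<close> is empty.\<close>
  case True
  then show ?thesis using Z by simp
next
  case False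
  define D where "D = (\<lambda>n. Z \<inter> disjointed (\<lambda>n. C (from_nat_into I n)) n)"
  have in_I: "from_nat_into I n \<in> I" for n using False by (rule from_nat_into)
  have D: "D n \<in> sets M" for n
    using sets.range_disjointed_sets[of "\<lambda>n. C (from_nat_into I n)" M] C in_I Z(1)
    by (auto simp: D_def)
  have sub: "D n \<subseteq> Z \<inter> C (from_nat_into I n)" for n
    using disjointed_subset[of "\<lambda>n. C (from_nat_into I n)" n] by (auto simp: D_def)
  have "(\<Union>n. D n) = Z \<inter> (\<Union>n. C (from_nat_into I n))"
    using UN_disjointed_eq[of "\<lambda>n. C (from_nat_into I n)"] by (auto simp: D_def)
  also have "(\<Union>n. C (from_nat_into I n)) = \<Union> (C ` range (from_nat_into I))"
    by (simp add: image_image)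
  also have "Z \<inter> \<Union> (C ` range (from_nat_into I)) = Z"
    unfolding range_from_nat_into[OF False I] using Z(2) by blast
  finally have UN: "(\<Union>n. D n) = Z" .
  have disj: "disjoint_family D"
    using disjoint_family_disjointed[of "\<lambda>n. C (from_nat_into I n)"]
    by (auto simp: disjoint_family_on_def D_def)
  have range_D: "range D \<subseteq> sets M" using D by blast
  have "emeasure N Z = (\<Sum>n. emeasure N (D n))"
    using suminf_emeasure[of D N] range_D disj UN N by simp
  also have "\<dots> \<le> (\<Sum>n. q * emeasure L (D n))"
    by (intro suminf_le le[OF in_I D sub] summableI)
  also have "\<dots> = q * emeasure L Z"
    using suminf_emeasure[of D L] range_D disj UN L by (simp add: ennreal_suminf_cmult)
  finally show ?thesis .
qed

text \<open>For finite \<open>y = r > 0\<close> the choice \<open>q = 1 + e / r\<close> turns the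
  factor into an additive error \<open>e\<close>. For \<open>r = 0\<close> the single factor 2
  already forces \<open>x = 0\<close>.\<close>

lemma ennreal_le_by_factor:
  fixes x y :: ennreal
  assumes "\<And>q::real. 1 < q \<Longrightarrow> x \<le> ennreal q * y"
  shows "x \<le> y"
proof (cases y)
  case (real r)
  show ?thesis
  proof (cases "r = 0")
    case True
    then show ?thesis using assms[of 2] real by simp
  next
    case False
    then have r: "r > 0" using real by simp
    show ?thesis
    proof (rule ennreal_le_epsilon)
      fix e :: real assume "0 < e"
      then have "x \<le> ennreal (1 + e / r) * y" using r by (intro assms) simp
      also have "\<dots> = ennreal ((1 + e / r) * r)"
        unfolding real(2) using r \<open>0 < e\<close> by (intro ennreal_mult[symmetric]) auto
      also have "(1 + e / r) * r = r + e" using r by (simp add: field_simps)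
      also have "ennreal (r + e) = y + ennreal e" using r \<open>0 < e\<close> real by simp
      finally show "x \<le> y + ennreal e" .
    qed
  qed
qed simp

section \<open>A common framework for unstable and stable leaves\<close>

text \<open>This is the summand of both leaf measures: \<open>T\<close> is \<open>shift\<close> with
  \<open>cyl_plus X\<close> and an unstable leaf \<open>W\<close>, or \<open>inv shift\<close> with
  \<open>cyl_minus X\<close> and a stable leaf; see \<open>unstable_value_eq\<close> and
  \<open>stable_value_eq\<close>.\<close>

definition orbit_weight ::
    "((int \<Rightarrow> 'a) \<Rightarrow> int \<Rightarrow> 'a) \<Rightarrow> ((int \<Rightarrow> 'a) \<Rightarrow> real) \<Rightarrow> real \<Rightarrow> ('a list \<Rightarrow> (int \<Rightarrow> 'a) set) \<Rightarrow>
      (int \<Rightarrow> 'a) set \<Rightarrow> 'a list \<Rightarrow> ennreal" where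
  "orbit_weight T \<phi> P cyl W w =
     exp_ereal ((SUP y\<in>W \<inter> cyl w. ereal (\<Sum>k<length w. \<phi> ((T ^^ k) y))) - ereal (real (length w) * P))"

text \<open>
  Common to both cases: \<open>T\<close> is \<open>\<sigma>\<close> or \<open>\<sigma>\<^sup>-\<^sup>1\<close> with inverse \<open>g\<close>, and \<open>W'\<close> is the leaf of \<open>T x\<close>.
  Only \<open>g\<close> maps leaf to leaf, \<open>W' \<rightarrow> W\<close>; by \<open>T_W'\<close>, two letters of \<open>y \<in> W\<close> decide whether
  \<open>T y \<in> W'\<close>.
\<close>

locale leaf_transport =
  fixes X :: "(int \<Rightarrow> 'a) set" and \<phi> :: "(int \<Rightarrow> 'a) \<Rightarrow> real" and P :: real
    and cyl :: "'a list \<Rightarrow> (int \<Rightarrow> 'a) set" and V :: "'a list set"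
    and W W' :: "(int \<Rightarrow> 'a) set" and T g :: "(int \<Rightarrow> 'a) \<Rightarrow> int \<Rightarrow> 'a"
    and extend reduce :: "'a list \<Rightarrow> 'a list"
  assumes \<phi>: "continuous_potential X \<phi>"
    and W_X: "W \<subseteq> X"
    and V: "countable V"
    and small: "\<And>y k. y \<in> W \<Longrightarrow> \<exists>v\<in>V. y \<in> cyl v \<and> (\<forall>z\<in>W \<inter> cyl v. agree k y z)"
    and cyl_agree: "\<And>y w. y \<in> cyl w \<Longrightarrow> \<exists>k. \<forall>z\<in>X. agree k y z \<longrightarrow> z \<in> cyl w"
    and nested: "\<And>v w. length v \<le> length w \<Longrightarrow> cyl w \<subseteq> cyl v \<or> cyl w \<inter> cyl v = {}"
    and cyl_language: "\<And>y w. y \<in> cyl w \<Longrightarrow> w \<in> language X"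
    and g_T: "\<And>y. g (T y) = y" and T_g: "\<And>y. T (g y) = y"
    and g_W: "\<And>z. z \<in> W' \<Longrightarrow> g z \<in> W"
    and g_agree: "\<And>k y z. agree (Suc k) y z \<Longrightarrow> agree k (g y) (g z)"
    and reduce: "\<And>y w. y \<in> cyl w \<Longrightarrow> w \<noteq> [] \<Longrightarrow> T y \<in> cyl (reduce w)"
    and length_reduce: "\<And>w. length (reduce w) = length w - 1"
    and extend: "\<And>z v. z \<in> W' \<Longrightarrow> z \<in> cyl v \<Longrightarrow> g z \<in> cyl (extend v)"
    and length_extend: "\<And>v. length (extend v) = Suc (length v)"
    and reduce_extend: "\<And>v. reduce (extend v) = v"
    and extend_reduce: "\<And>y w. y \<in> W \<Longrightarrow> y \<in> cyl w \<Longrightarrow> w \<noteq> [] \<Longrightarrow> extend (reduce w) = w"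
    and T_W': "\<And>y y' w. y \<in> W \<Longrightarrow> y \<in> cyl w \<Longrightarrow> 2 \<le> length w \<Longrightarrow> y' \<in> W \<Longrightarrow> y' \<in> cyl w \<Longrightarrow>
      T y' \<in> W' \<Longrightarrow> T y \<in> W'"
begin

abbreviation "weight \<equiv> orbit_weight T \<phi> P cyl W"
abbreviation "weight' \<equiv> orbit_weight T \<phi> P cyl W'"

text \<open>The map \<open>T\<close> is a bijection from \<open>W \<inter> cyl w\<close> onto
  \<open>W' \<inter> cyl (reduce w)\<close> with inverse \<open>g\<close>: once a single point
  \<open>y\<close> is mapped into \<open>W'\<close>, \<open>T_W'\<close> sends all the others there,
  and this requires two letters of \<open>w\<close>. Along the bijection the orbit sum loses the
  term \<open>\<phi> z\<close> and the normalisation loses one \<open>P\<close>, so the exponents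
  differ by \<open>\<phi> z - P\<close>, which lies in \<open>[a - P, b - P]\<close>.\<close>

lemma weight_compare:
  assumes y: "y \<in> W" "y \<in> cyl w" "T y \<in> W'" and w: "2 \<le> length w"
    and bounds: "\<And>z. z \<in> W \<Longrightarrow> z \<in> cyl w \<Longrightarrow> a \<le> \<phi> z \<and> \<phi> z \<le> b"
  shows "weight' (reduce w) \<le> ennreal (exp (P - a)) * weight w"
    and "weight w \<le> ennreal (exp (b - P)) * weight' (reduce w)"
proof -
  have w0: "w \<noteq> []" using w by auto
  define n where "n = length (reduce w)"
  have n: "length w = Suc n" "length (reduce w) = n" using w length_reduce[of w] by (auto simp: n_def)
  have S: "(\<Sum>k<Suc n. \<phi> ((T ^^ k) z)) = \<phi> z + (\<Sum>k<n. \<phi> ((T ^^ k) (T z)))" for z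
    by (simp add: sum.lessThan_Suc_shift funpow_swap1 del: sum.lessThan_Suc)
  show "weight' (reduce w) \<le> ennreal (exp (P - a)) * weight w"
    unfolding orbit_weight_def n
  proof (rule exp_ereal_SUP_le)
    fix z assume z: "z \<in> W' \<inter> cyl (reduce w)"
    \<comment> \<open>The witness \<open>y\<close> ensures that \<open>extend\<close> restores
      exactly the letter that \<open>reduce\<close> removed from \<open>w\<close>.\<close>
    then have gz: "g z \<in> W" "g z \<in> cyl w"
      using g_W extend[of z "reduce w"] extend_reduce[OF y(1,2) w0] by auto
    show "\<exists>ya\<in>W \<inter> cyl w. (\<Sum>k<n. \<phi> ((T ^^ k) z)) - real n * P \<le>
        P - a + ((\<Sum>k<Suc n. \<phi> ((T ^^ k) ya)) - real (Suc n) * P)"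
    proof (rule bexI)
      show "(\<Sum>k<n. \<phi> ((T ^^ k) z)) - real n * P \<le>
          P - a + ((\<Sum>k<Suc n. \<phi> ((T ^^ k) (g z))) - real (Suc n) * P)"
        unfolding S T_g of_nat_Suc distrib_right using bounds[OF gz] by linarith
    qed (use gz in blast)
  qed
  show "weight w \<le> ennreal (exp (b - P)) * weight' (reduce w)"
    unfolding orbit_weight_def n
  proof (rule exp_ereal_SUP_le)
    fix z assume z: "z \<in> W \<inter> cyl w"
    then have Tz: "T z \<in> W'" "T z \<in> cyl (reduce w)"
      using T_W'[of z w y] reduce[of z w] y w w0 by auto
    show "\<exists>z'\<in>W' \<inter> cyl (reduce w). (\<Sum>k<Suc n. \<phi> ((T ^^ k) z)) - real (Suc n) * P \<le>
        b - P + ((\<Sum>k<n. \<phi> ((T ^^ k) z')) - real n * P)"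
    proof (rule bexI)
      have "a \<le> \<phi> z \<and> \<phi> z \<le> b" using z bounds by blast
      then show "(\<Sum>k<Suc n. \<phi> ((T ^^ k) z)) - real (Suc n) * P \<le>
          b - P + ((\<Sum>k<n. \<phi> ((T ^^ k) (T z))) - real n * P)"
        unfolding S of_nat_Suc distrib_right by linarith
    qed (use Tz in blast)
  qed
qed

text \<open>A word at least as long as \<open>u\<close> whose cylinder meets \<open>B\<close> has
  its cylinder inside \<open>cyl u\<close>, by nestedness, so the bounds on \<open>\<phi>\<close>
  hold there and \<open>weight_compare\<close> applies. Covers are pushed forward by
  \<open>reduce\<close> and pulled back by \<open>extend\<close>.\<close>

lemma cover_value_compare:
  assumes B: "B \<subseteq> W" "B \<subseteq> cyl u" "T ` B \<subseteq> W'"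
    and bounds: "\<And>z. z \<in> W \<Longrightarrow> z \<in> cyl u \<Longrightarrow> a \<le> \<phi> z \<and> \<phi> z \<le> b"
  shows "cover_value X cyl weight' (T ` B) \<le> ennreal (exp (P - a)) * cover_value X cyl weight B"
    and "cover_value X cyl weight B \<le> ennreal (exp (b - P)) * cover_value X cyl weight' (T ` B)"
proof -
  have sub: "cyl w \<subseteq> cyl u" if "y \<in> B" "y \<in> cyl w" "length u \<le> length w" for y w
    using nested[OF that(3)] that B by blast
  show "cover_value X cyl weight' (T ` B) \<le> ennreal (exp (P - a)) * cover_value X cyl weight B"
  proof (rule cover_value_image_le[where f = reduce and ?N0.0 = "max 2 (length u)"])
    fix w y assume y: "y \<in> B" "y \<in> cyl w" and w: "max 2 (length u) \<le> length w"
    have "a \<le> \<phi> z \<and> \<phi> z \<le> b" if "z \<in> W" "z \<in> cyl w" for z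
      using sub[OF y] w that by (intro bounds) auto
    moreover have "y \<in> W" "T y \<in> W'" "2 \<le> length w" using y B w by auto
    ultimately have "weight' (reduce w) \<le> ennreal (exp (P - a)) * weight w"
      using weight_compare(1)[of y w a b] y(2) by blast
    moreover have "T y \<in> cyl (reduce w)" using w by (intro reduce y) auto
    ultimately show "reduce w \<in> language X \<and> length w \<le> Suc (length (reduce w)) \<and>
        T y \<in> cyl (reduce w) \<and> weight' (reduce w) \<le> ennreal (exp (P - a)) * weight w"
      using cyl_language w by (auto simp: length_reduce)
  qed simp
  \<comment> \<open>The converse bound is the image estimate for \<open>g\<close>, since
    \<open>g\<close> T \<open>B = B\<close>. One letter in \<open>v\<close> suffices here, as
    \<open>extend v\<close> then has the two letters that \<open>weight_compare\<close> asks
    for.\<close>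
  have "cover_value X cyl weight (g ` T ` B) \<le> ennreal (exp (b - P)) * cover_value X cyl weight' (T ` B)"
  proof (rule cover_value_image_le[where f = extend and ?N0.0 = "max 1 (length u)"])
    fix v z assume z: "z \<in> T ` B" "z \<in> cyl v" and v: "max 1 (length u) \<le> length v"
    then obtain y where y: "y \<in> B" "z = T y" by auto
    have yw: "y \<in> cyl (extend v)" using extend[of z v] z y B by (auto simp: g_T)
    have "a \<le> \<phi> z \<and> \<phi> z \<le> b" if "z \<in> W" "z \<in> cyl (extend v)" for z
      using sub[OF y(1) yw] v that by (intro bounds) (auto simp: length_extend)
    moreover have "y \<in> W" "T y \<in> W'" "2 \<le> length (extend v)"
      using y B v by (auto simp: length_extend)
    ultimately have "weight (extend v) \<le> ennreal (exp (b - P)) * weight' (reduce (extend v))"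
      using weight_compare(2)[of y "extend v" a b] yw by blast
    then have "weight (extend v) \<le> ennreal (exp (b - P)) * weight' v"
      by (simp only: reduce_extend)
    then show "extend v \<in> language X \<and> length v \<le> Suc (length (extend v)) \<and>
        g z \<in> cyl (extend v) \<and> weight (extend v) \<le> ennreal (exp (b - P)) * weight' v"
      using cyl_language yw y by (auto simp: length_extend g_T)
  qed simp
  then show "cover_value X cyl weight B \<le> ennreal (exp (b - P)) * cover_value X cyl weight' (T ` B)"
    by (simp add: image_image g_T)
qed

text \<open>The measures enter only through their spaces, Borel sets and cover values, which
  \<open>emeasure_unstable_measure\<close> and \<open>emeasure_stable_measure\<close> provide for
  the leaf measures. Equality on \<open>Z\<close> follows from comparison up to every factor
  \<open>q > 1\<close>.\<close>

lemma emeasure_image: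
  assumes M: "space M = W" "sets M = borel_subsets W"
      "\<And>B. B \<in> borel_subsets W \<Longrightarrow> emeasure M B = cover_value X cyl weight B"
    and M': "space M' = W'" "sets M' = borel_subsets W'"
      "\<And>B. B \<in> borel_subsets W' \<Longrightarrow> emeasure M' B = cover_value X cyl weight' B"
    and Z: "Z \<in> borel_subsets W" "T ` Z \<subseteq> W'"
  shows "emeasure M' (T ` Z) = (\<integral>\<^sup>+y\<in>Z. ennreal (exp (- \<phi> y + P)) \<partial>M)"
proof -
  define h where "h = (\<lambda>y. ennreal (exp (- \<phi> y + P)))"
  \<comment> \<open>\<open>\<nu>\<close> is \<open>B \<mapsto> M' (T ` B)\<close> for \<open>B \<subseteq> Z\<close>; images under \<open>T\<close> become preimages under \<open>g\<close>, hence measurable.\<close>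
  define \<nu> where "\<nu> = distr M' M g"
  define \<mu> where "\<mu> = density M h"
  have sets_M: "sets M = sigma_sets W {U. openin (shift_topology W) U}"
    using M(2) by (simp add: borel_subsets_def)
  have "\<phi> \<in> borel_measurable M"
  proof (rule borel_measurableI)
    fix S :: "real set" assume S: "open S"
    show "\<phi> -` S \<inter> space M \<in> sets M"
      unfolding M
    proof (rule borel_subsets_openI)
      fix y assume y: "y \<in> \<phi> -` S \<inter> W"
      then obtain e where e: "e > 0" "\<And>t. \<bar>t - \<phi> y\<bar> < e \<Longrightarrow> t \<in> S"
        using S unfolding open_dist dist_real_def by blast
      then show "\<exists>k. \<forall>z\<in>W. agree k y z \<longrightarrow> z \<in> \<phi> -` S \<inter> W"
        using continuous_potential_agree[OF \<phi>, of y e] y W_X by blast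
    qed simp
  qed
  then have h: "h \<in> borel_measurable M" unfolding h_def by measurable
  have g: "g \<in> measurable M' M"
  proof (rule measurable_sigma_sets[OF sets_M])
    show "{U. openin (shift_topology W) U} \<subseteq> Pow W" by (auto simp: openin_shift_topology_iff)
    show "g \<in> space M' \<rightarrow> W" using g_W M' by auto
    fix U assume "U \<in> {U. openin (shift_topology W) U}"
    then have U: "\<forall>y\<in>U. \<exists>k. \<forall>z\<in>W. agree k y z \<longrightarrow> z \<in> U"
      by (auto simp: openin_shift_topology_iff)
    show "g -` U \<inter> space M' \<in> sets M'"
      unfolding M'
    proof (rule borel_subsets_openI)
      fix y assume y: "y \<in> g -` U \<inter> W'"
      then obtain k where k: "\<forall>z\<in>W. agree k (g y) z \<longrightarrow> z \<in> U" using U by auto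
      \<comment> \<open>Since \<open>g\<close> moves coordinates by one place, the window has to be
        one larger before \<open>g\<close> is applied; thus \<open>g\<close> is continuous and so
        Borel measurable.\<close>
      have "z \<in> g -` U \<inter> W'" if z: "z \<in> W'" "agree (Suc k) y z" for z
        using k g_agree[OF z(2)] g_W[OF z(1)] z(1) by blast
      then show "\<exists>k. \<forall>z\<in>W'. agree k y z \<longrightarrow> z \<in> g -` U \<inter> W'" by blast
    qed simp
  qed
  \<comment> \<open>Because \<open>T\<close>
    Z\<open>lies in\<close>W'\<open>, restricting the preimage to\<close>space
    M'\<open>removes no point of\<close>T \<open>B\<close>.\<close>
  have ms: "g -` B \<inter> space M' = T ` B" if "B \<subseteq> Z" for B
    using that Z(2) M' by (auto simp: g_T T_g image_iff) (metis T_g)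
  have \<nu>: "emeasure \<nu> B = cover_value X cyl weight' (T ` B)" if B: "B \<in> sets M" "B \<subseteq> Z" for B
  proof -
    have "T ` B \<in> sets M'" using measurable_sets[OF g B(1)] ms[OF B(2)] by simp
    then show ?thesis using emeasure_distr[OF g B(1)] ms[OF B(2)] M' by (simp add: \<nu>_def)
  qed
  have \<mu>: "emeasure \<mu> B = (\<integral>\<^sup>+y. h y * indicator B y \<partial>M)" if "B \<in> sets M" for B
    using that h by (simp add: \<mu>_def emeasure_density)
  have cyl: "W \<inter> cyl u \<in> sets M" for u
    unfolding M
  proof (rule borel_subsets_openI)
    fix y assume "y \<in> W \<inter> cyl u"
    then show "\<exists>k. \<forall>z\<in>W. agree k y z \<longrightarrow> z \<in> W \<inter> cyl u" using cyl_agree[of y u] W_X by blast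
  qed simp
  \<comment> \<open>Both \<open>\<nu> B\<close> and \<open>\<mu> B\<close> lie between
    \<open>exp (P - b)\<close> and \<open>exp (P - a)\<close> times \<open>emeasure M B\<close>: the
    first by \<open>cover_value_compare\<close>, the second by bounding the density. The ratio of
    the two factors is \<open>exp (b - a)\<close>.\<close>
  have local: "emeasure \<nu> B \<le> ennreal (exp (b - a)) * emeasure \<mu> B"
      "emeasure \<mu> B \<le> ennreal (exp (b - a)) * emeasure \<nu> B"
    if B: "B \<in> sets M" "B \<subseteq> Z" "B \<subseteq> W \<inter> cyl u"
      and bounds: "\<And>z. z \<in> W \<Longrightarrow> z \<in> cyl u \<Longrightarrow> a \<le> \<phi> z \<and> \<phi> z \<le> b" for B u a b
  proof -
    have MB: "emeasure M B = cover_value X cyl weight B" using B M by simp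
    have TB: "T ` B \<subseteq> W'" using B(2) Z(2) by blast
    have c: "emeasure \<nu> B \<le> ennreal (exp (P - a)) * emeasure M B"
        "emeasure M B \<le> ennreal (exp (b - P)) * emeasure \<nu> B"
      unfolding \<nu>[OF B(1,2)] MB using cover_value_compare[of B u a b] B(3) TB bounds by auto
    have "ennreal (exp (P - b)) * emeasure M B = (\<integral>\<^sup>+y. ennreal (exp (P - b)) * indicator B y \<partial>M)"
      using B(1) by (simp add: nn_integral_cmult_indicator)
    also have "\<dots> \<le> emeasure \<mu> B"
      unfolding \<mu>[OF B(1)]
    proof (rule nn_integral_mono)
      fix y show "ennreal (exp (P - b)) * indicator B y \<le> h y * indicator B y"
        using bounds[of y] B(3) by (auto simp: h_def indicator_def)
    qed
    finally have l: "ennreal (exp (P - b)) * emeasure M B \<le> emeasure \<mu> B" .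
    have "emeasure \<mu> B \<le> (\<integral>\<^sup>+y. ennreal (exp (P - a)) * indicator B y \<partial>M)"
      unfolding \<mu>[OF B(1)]
    proof (rule nn_integral_mono)
      fix y show "h y * indicator B y \<le> ennreal (exp (P - a)) * indicator B y"
        using bounds[of y] B(3) by (auto simp: h_def indicator_def)
    qed
    also have "\<dots> = ennreal (exp (P - a)) * emeasure M B"
      using B(1) by (simp add: nn_integral_cmult_indicator)
    finally have r: "emeasure \<mu> B \<le> ennreal (exp (P - a)) * emeasure M B" .
    have e: "ennreal (exp (b - a)) = ennreal (exp (b - P)) * ennreal (exp (P - a))"
        "ennreal (exp (P - a)) = ennreal (exp (b - a)) * ennreal (exp (P - b))"
      by (simp_all flip: ennreal_mult exp_add)
    show "emeasure \<nu> B \<le> ennreal (exp (b - a)) * emeasure \<mu> B"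
      using c(1) mult_left_mono[OF l, of "ennreal (exp (b - a))"]
      unfolding e(2) mult.assoc by (auto intro: order_trans)
    show "emeasure \<mu> B \<le> ennreal (exp (b - a)) * emeasure \<nu> B"
      using r mult_left_mono[OF c(2), of "ennreal (exp (P - a))"]
      unfolding e(1) by (auto intro: order_trans simp: ac_simps)
  qed
  have factor: "emeasure \<nu> Z \<le> ennreal q * emeasure \<mu> Z \<and> emeasure \<mu> Z \<le> ennreal q * emeasure \<nu> Z"
    if q: "1 < q" for q :: real
  proof -
    \<comment> \<open>On these cylinders the values of \<open>\<phi>\<close> fit into an interval of
      length \<open>ln q\<close>, so the local factor \<open>exp (b - a)\<close> becomes
      \<open>q\<close>.\<close>
    define I where "I = {u \<in> V. \<exists>a b. b - a = ln q \<and> (\<forall>z\<in>W \<inter> cyl u. a \<le> \<phi> z \<and> \<phi> z \<le> b)}"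
    have I: "countable I" using V by (rule countable_subset[rotated]) (auto simp: I_def)
    have ZW: "Z \<subseteq> W" using Z(1) borel_subsets_Pow by blast
    have cover: "Z \<subseteq> (\<Union>u\<in>I. W \<inter> cyl u)"
    proof
      fix y assume "y \<in> Z"
      then have y: "y \<in> W" using ZW by blast
      obtain k where k: "\<forall>z\<in>X. agree k y z \<longrightarrow> \<bar>\<phi> z - \<phi> y\<bar> < ln q / 2"
        using continuous_potential_agree[OF \<phi>, of y "ln q / 2"] y W_X q by auto
      obtain u where u: "u \<in> V" "y \<in> cyl u" "\<forall>z\<in>W \<inter> cyl u. agree k y z" using small[OF y] by blast
      have "\<phi> y - ln q / 2 \<le> \<phi> z \<and> \<phi> z \<le> \<phi> y + ln q / 2" if z: "z \<in> W \<inter> cyl u" for z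
      proof -
        have "\<bar>\<phi> z - \<phi> y\<bar> < ln q / 2" using k u(3) z W_X by blast
        then show ?thesis by linarith
      qed
      then have "u \<in> I" unfolding I_def using u(1)
        by (intro CollectI conjI exI[of _ "\<phi> y - ln q / 2"] exI[of _ "\<phi> y + ln q / 2"]) auto
      then show "y \<in> (\<Union>u\<in>I. W \<inter> cyl u)" using u y by blast
    qed
    have le: "emeasure \<nu> B \<le> ennreal q * emeasure \<mu> B \<and> emeasure \<mu> B \<le> ennreal q * emeasure \<nu> B"
      if "u \<in> I" "B \<in> sets M" "B \<subseteq> Z \<inter> (W \<inter> cyl u)" for u B
    proof -
      obtain a b where ab: "b - a = ln q" "\<And>z. z \<in> W \<Longrightarrow> z \<in> cyl u \<Longrightarrow> a \<le> \<phi> z \<and> \<phi> z \<le> b"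
        using \<open>u \<in> I\<close> unfolding I_def by blast
      have "exp (b - a) = q" using ab(1) q by simp
      then show ?thesis using local[of B u a b] that ab(2) by auto
    qed
    have "sets \<nu> = sets M" "sets \<mu> = sets M" by (simp_all add: \<nu>_def \<mu>_def)
    then show ?thesis
      using emeasure_le_by_countable_cover[of \<nu> M \<mu> I "\<lambda>u. W \<inter> cyl u" Z "ennreal q"]
        emeasure_le_by_countable_cover[of \<mu> M \<nu> I "\<lambda>u. W \<inter> cyl u" Z "ennreal q"]
        I cyl Z(1) M(2) cover le by (simp only: simp_thms)
  qed
  have ZM: "Z \<in> sets M" using Z M by simp
  have "emeasure M' (T ` Z) = emeasure \<nu> Z"
    unfolding \<nu>_def emeasure_distr[OF g ZM] ms[OF order_refl] ..
  also have "\<dots> = emeasure \<mu> Z"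
  proof (rule antisym)
    show "emeasure \<nu> Z \<le> emeasure \<mu> Z" using factor by (rule ennreal_le_by_factor[OF conjunct1])
    show "emeasure \<mu> Z \<le> emeasure \<nu> Z" using factor by (rule ennreal_le_by_factor[OF conjunct2])
  qed
  finally show ?thesis unfolding \<mu>[OF ZM] h_def .
qed

end

section \<open>Translates, words and leaf measures of a shift space\<close>

lemma shift_space_invariant:
  assumes "two_sided_shift_space A X" "y \<in> X"
  shows "shift y \<in> X" "inv shift y \<in> X"
proof -
  have X: "shift ` X = X" using assms(1) by (simp add: two_sided_shift_space_def)
  then show "shift y \<in> X" using assms(2) by blast
  have "inv shift ` X = X" using X image_inv_f_f[OF bij_is_inj[OF bij_shift], of X] by simp
  then show "inv shift y \<in> X" using assms(2) by blast
qed

lemma shift_space_translate: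
  assumes "two_sided_shift_space A X" "y \<in> X"
  shows "(\<lambda>i. y (i - int n)) \<in> X"
proof (induction n)
  case (Suc n)
  have "inv shift (\<lambda>i. y (i - int n)) \<in> X" by (rule shift_space_invariant(2)[OF assms(1) Suc])
  then show ?case by (simp add: inv_shift algebra_simps)
qed (use assms in simp)

lemma cyl_plus_language: "y \<in> cyl_plus X w \<Longrightarrow> w \<in> language X"
  by (auto simp: language_def language_n_def)

text \<open>The language is defined by occurrences starting at 0. Translating the point by
  \<open>length w - 1\<close> places moves an occurrence of \<open>w\<close> ending at 0 to one
  starting at 0.\<close>

lemma cyl_minus_language:
  assumes "two_sided_shift_space A X" "y \<in> cyl_minus X w"
  shows "w \<in> language X"
proof (cases "length w")
  case 0
  then show ?thesis using assms by (intro cyl_plus_language[of y]) (simp add: cyl_plus_iff cyl_minus_iff)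
next
  case (Suc m)
  have y: "y \<in> X" "\<And>i. i < length w \<Longrightarrow> y (- int i) = w ! (length w - 1 - i)"
    using assms(2) by (auto simp: cyl_minus_iff)
  have "(\<lambda>i. y (i - int m)) \<in> cyl_plus X w"
    unfolding cyl_plus_iff
  proof (intro conjI allI impI)
    show "(\<lambda>i. y (i - int m)) \<in> X" by (rule shift_space_translate[OF assms(1) y(1)])
    fix i assume i: "i < length w"
    have "int i - int m = - int (m - i)" "m - (m - i) = i" using i Suc by auto
    then show "y (int i - int m) = w ! i" using y(2)[of "m - i"] Suc by simp
  qed
  then show ?thesis by (rule cyl_plus_language)
qed

lemma sigma_algebra_borel_subsets: "sigma_algebra M (borel_subsets M)"
  unfolding borel_subsets_def
  by (intro sigma_algebra_sigma_sets) (auto simp: openin_shift_topology_iff)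

lemma space_sets_leaf_measures:
  "space (unstable_measure X \<phi> x) = W_u X x" "sets (unstable_measure X \<phi> x) = borel_subsets (W_u X x)"
  "space (stable_measure X \<phi> x) = W_s X x" "sets (stable_measure X \<phi> x) = borel_subsets (W_s X x)"
  unfolding unstable_measure_def stable_measure_def
  by (simp_all add: space_measure_of[OF borel_subsets_Pow] sets_measure_of[OF borel_subsets_Pow]
      sigma_algebra.sigma_sets_eq[OF sigma_algebra_borel_subsets])

lemma unstable_value_eq:
  "unstable_value X \<phi> x =
    cover_value X (cyl_plus X) (orbit_weight shift \<phi> (pressure X \<phi>) (cyl_plus X) (W_u X x))"
  unfolding unstable_value_def orbit_weight_def unstable_weight_def birkhoff_sum_def ..

lemma stable_value_eq:
  "stable_value X \<phi> x =
    cover_value X (cyl_minus X) (orbit_weight (inv shift) \<phi> (pressure X \<phi>) (cyl_minus X) (W_s X x))"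
  unfolding stable_value_def orbit_weight_def stable_weight_def backward_birkhoff_sum_def ..

section \<open>The two instances of the framework and the conclusion\<close>

text \<open>Words are read from coordinate 0 to the right, so \<open>shift\<close> removes the first
  letter. On the leaf of \<open>x\<close> this letter is \<open>x 0\<close>, which is why putting
  \<open>x 0\<close> in front undoes \<open>tl\<close>.\<close>

lemma leaf_transport_unstable:
  assumes X: "two_sided_shift_space A X" and \<phi>: "continuous_potential X \<phi>"
  shows "leaf_transport X \<phi> (cyl_plus X) (lists A) (W_u X x) (W_u X (shift x)) shift (inv shift)
    (\<lambda>v. x 0 # v) tl"
proof
  show "continuous_potential X \<phi>" by (rule \<phi>)
  show "W_u X x \<subseteq> X" by (auto simp: W_u_def)
  show "countable (lists A)"
    using X by (intro countable_lists countable_finite) (simp add: two_sided_shift_space_def)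
  show "\<exists>v\<in>lists A. y \<in> cyl_plus X v \<and> (\<forall>z\<in>W_u X x \<inter> cyl_plus X v. agree k y z)"
    if y: "y \<in> W_u X x" for y k
  proof -
    have yX: "y \<in> X" using y by (simp add: W_u_def)
    define v where "v = map y [0..int k]"
    have "v \<in> lists A" using shift_space_alphabet[OF X yX] by (auto simp: v_def)
    moreover have v: "y \<in> cyl_plus X v" using yX by (simp add: v_def cyl_plus_def)
    moreover have "y n = z n" if z: "z \<in> W_u X x \<inter> cyl_plus X v" and n: "\<bar>n\<bar> \<le> int k" for z n
    proof (cases "n \<le> 0")
      case True
      then show ?thesis using y z by (simp add: W_u_def)
    next
      case False
      then have "nat n < length v" using n by (simp add: v_def)
      then have "z (int (nat n)) = y (int (nat n))"
        using z v unfolding cyl_plus_iff Int_iff by metis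
      then show ?thesis using False by simp
    qed
    ultimately show ?thesis by blast
  qed
  show "\<exists>k. \<forall>z\<in>X. agree k y z \<longrightarrow> z \<in> cyl_plus X w" if "y \<in> cyl_plus X w" for y w
    using that by (intro exI[of _ "length w"]) (auto simp: cyl_plus_iff)
  show "cyl_plus X w \<subseteq> cyl_plus X v \<or> cyl_plus X w \<inter> cyl_plus X v = {}"
    if "length v \<le> length w" for v w using that by (rule cyl_plus_nested)
  show "w \<in> language X" if "y \<in> cyl_plus X w" for y w using that by (rule cyl_plus_language)
  show "inv shift (shift y) = y" "shift (inv shift y) = y" for y :: "int \<Rightarrow> 'a"
    by (simp_all add: inv_shift) (simp_all add: shift_def)
  show "inv shift z \<in> W_u X x" if "z \<in> W_u X (shift x)" for z
    using that shift_space_invariant(2)[OF X, of z] by (auto simp: W_u_def inv_shift) (simp add: shift_def)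
  show "agree k (inv shift y) (inv shift z)" if "agree (Suc k) y z" for k y z
    using that by (auto simp: inv_shift)
  show "shift y \<in> cyl_plus X (tl w)" if "y \<in> cyl_plus X w" "w \<noteq> []" for y w
    using that shift_space_invariant(1)[OF X, of y]
    by (cases w) (auto simp: cyl_plus_iff shift_def algebra_simps dest: spec[of _ "Suc _"])
  show "inv shift z \<in> cyl_plus X (x 0 # v)" if "z \<in> W_u X (shift x)" "z \<in> cyl_plus X v" for z v
    using that shift_space_invariant(2)[OF X, of z]
    by (auto simp: cyl_plus_iff W_u_def inv_shift nth_Cons split: nat.split) (simp add: shift_def)
  show "x 0 # tl w = w" if "y \<in> W_u X x" "y \<in> cyl_plus X w" "w \<noteq> []" for y w
    using that by (cases w) (auto simp: cyl_plus_iff W_u_def)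
  show "shift y \<in> W_u X (shift x)"
    if "y \<in> W_u X x" "y \<in> cyl_plus X w" "2 \<le> length w" "y' \<in> W_u X x" "y' \<in> cyl_plus X w"
      "shift y' \<in> W_u X (shift x)" for y y' w
  proof -
    \<comment> \<open>Points of the leaf of \<open>x\<close> already agree with \<open>x\<close> up
      to coordinate 0; lying in the leaf of \<open>shift x\<close> after one shift adds only
      coordinate 1, the second letter of \<open>w\<close>.\<close>
    have "y 1 = y' 1" using that by (auto simp: cyl_plus_iff dest!: spec[of _ 1])
    moreover have "y' 1 = x 1" using that(6) by (auto simp: W_u_def shift_def)
    ultimately have "y (k + 1) = x (k + 1)" if "k \<le> 0" for k
      using that \<open>y \<in> W_u X x\<close> by (cases "k = 0") (auto simp: W_u_def)
    then show ?thesis using that(1) shift_space_invariant(1)[OF X, of y] by (auto simp: W_u_def shift_def)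
  qed
qed auto

text \<open>Words now end at coordinate 0, so \<open>inv shift\<close> removes the last letter,
  which is \<open>x 0\<close> on the leaf of \<open>x\<close>; appending \<open>x 0\<close> undoes
  \<open>butlast\<close>.\<close>

lemma leaf_transport_stable:
  assumes X: "two_sided_shift_space A X" and \<phi>: "continuous_potential X \<phi>"
  shows "leaf_transport X \<phi> (cyl_minus X) (lists A) (W_s X x) (W_s X (inv shift x)) (inv shift) shift
    (\<lambda>v. v @ [x 0]) butlast"
proof
  show "continuous_potential X \<phi>" by (rule \<phi>)
  show "W_s X x \<subseteq> X" by (auto simp: W_s_def)
  show "countable (lists A)"
    using X by (intro countable_lists countable_finite) (simp add: two_sided_shift_space_def)
  show "\<exists>v\<in>lists A. y \<in> cyl_minus X v \<and> (\<forall>z\<in>W_s X x \<inter> cyl_minus X v. agree k y z)"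
    if y: "y \<in> W_s X x" for y k
  proof -
    have yX: "y \<in> X" using y by (simp add: W_s_def)
    define v where "v = map y [- int k..0]"
    have "v \<in> lists A" using shift_space_alphabet[OF X yX] by (auto simp: v_def)
    moreover have v: "y \<in> cyl_minus X v" using yX by (simp add: v_def cyl_minus_def)
    moreover have "y n = z n" if z: "z \<in> W_s X x \<inter> cyl_minus X v" and n: "\<bar>n\<bar> \<le> int k" for z n
    proof (cases "n \<ge> 0")
      case True
      then show ?thesis using y z by (simp add: W_s_def)
    next
      case False
      then have "nat (- n) < length v" using n by (simp add: v_def)
      then have "z (- int (nat (- n))) = y (- int (nat (- n)))"
        using z v unfolding cyl_minus_iff Int_iff by metis
      then show ?thesis using False by simp
    qed
    ultimately show ?thesis by blast
  qed
  show "\<exists>k. \<forall>z\<in>X. agree k y z \<longrightarrow> z \<in> cyl_minus X w" if "y \<in> cyl_minus X w" for y w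
    using that by (intro exI[of _ "length w"]) (auto simp: cyl_minus_iff)
  show "cyl_minus X w \<subseteq> cyl_minus X v \<or> cyl_minus X w \<inter> cyl_minus X v = {}"
    if "length v \<le> length w" for v w using that by (rule cyl_minus_nested)
  show "w \<in> language X" if "y \<in> cyl_minus X w" for y w using X that by (rule cyl_minus_language)
  show "inv shift (shift y) = y" "shift (inv shift y) = y" for y :: "int \<Rightarrow> 'a"
    by (simp_all add: inv_shift) (simp_all add: shift_def)
  show "shift z \<in> W_s X x" if "z \<in> W_s X (inv shift x)" for z
    using that shift_space_invariant(1)[OF X, of z] by (auto simp: W_s_def inv_shift) (simp add: shift_def)
  show "agree k (shift y) (shift z)" if "agree (Suc k) y z" for k and y z :: "int \<Rightarrow> 'a"
    using that by (auto simp: shift_def)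
  show "inv shift y \<in> cyl_minus X (butlast w)" if y: "y \<in> cyl_minus X w" and "w \<noteq> []" for y w
    unfolding cyl_minus_iff
  proof (intro conjI allI impI)
    show "inv shift y \<in> X" using shift_space_invariant(2)[OF X, of y] y by (simp add: cyl_minus_iff)
    \<comment> \<open>Coordinate \<open>- i\<close> of \<open>inv shift y\<close> is coordinate
      \<open>- i - 1\<close> of \<open>y\<close>, hence the passage to \<open>Suc i\<close>.\<close>
    fix i assume i: "i < length (butlast w)"
    then have "Suc i < length w" by simp
    then have "y (- int (Suc i)) = w ! (length w - 1 - Suc i)" using y unfolding cyl_minus_iff by blast
    moreover have "- int (Suc i) = - int i - 1" by simp
    ultimately have "y (- int i - 1) = w ! (length w - 1 - Suc i)" by (simp only:)
    then show "inv shift y (- int i) = butlast w ! (length (butlast w) - 1 - i)"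
      using i by (simp add: inv_shift nth_butlast)
  qed
  show "shift z \<in> cyl_minus X (v @ [x 0])" if z: "z \<in> W_s X (inv shift x)" "z \<in> cyl_minus X v" for z v
    unfolding cyl_minus_iff
  proof (intro conjI allI impI)
    show "shift z \<in> X" using shift_space_invariant(1)[OF X, of z] z by (simp add: cyl_minus_iff)
    fix i assume i: "i < length (v @ [x 0])"
    show "shift z (- int i) = (v @ [x 0]) ! (length (v @ [x 0]) - 1 - i)"
    proof (cases i)
      case 0
      then show ?thesis using z(1) by (simp add: shift_def W_s_def inv_shift)
    next
      case (Suc j)
      then have "z (- int j) = v ! (length v - 1 - j)" using z(2) i unfolding cyl_minus_iff by auto
      moreover have "length v - 1 - j < length v" using Suc i by auto
      ultimately show ?thesis using Suc by (simp add: shift_def nth_append)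
    qed
  qed
  show "butlast w @ [x 0] = w" if "y \<in> W_s X x" "y \<in> cyl_minus X w" "w \<noteq> []" for y w
  proof -
    have "last w = x 0" using that by (auto simp: cyl_minus_iff W_s_def last_conv_nth dest!: spec[of _ 0])
    then show ?thesis using that(3) append_butlast_last_id by metis
  qed
  show "inv shift y \<in> W_s X (inv shift x)"
    if "y \<in> W_s X x" "y \<in> cyl_minus X w" "2 \<le> length w" "y' \<in> W_s X x" "y' \<in> cyl_minus X w"
      "inv shift y' \<in> W_s X (inv shift x)" for y y' w
  proof -
    \<comment> \<open>The only new coordinate is -1, the last but one letter of
      \<open>w\<close>.\<close>
    have "y (- 1) = y' (- 1)" using that by (auto simp: cyl_minus_iff dest!: spec[of _ 1])
    moreover have "y' (- 1) = x (- 1)" using that(6) by (auto simp: W_s_def inv_shift dest!: spec[of _ 0])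
    ultimately have "y (k - 1) = x (k - 1)" if "k \<ge> 0" for k
      using that \<open>y \<in> W_s X x\<close> by (cases "k = 0") (auto simp: W_s_def)
    then show ?thesis using that(1) shift_space_invariant(2)[OF X, of y] by (auto simp: W_s_def inv_shift)
  qed
qed auto

theorem theorem1p6:
  fixes A :: "'a set" and X :: "(int \<Rightarrow> 'a) set" and \<phi> :: "(int \<Rightarrow> 'a) \<Rightarrow> real"
  assumes "two_sided_shift_space A X" and "continuous_potential X \<phi>"
  shows "(\<forall>x\<in>X. \<forall>Z. Z \<in> borel_subsets (W_u X x) \<and> shift ` Z \<subseteq> W_u X (shift x) \<longrightarrow>
            emeasure (unstable_measure X \<phi> (shift x)) (shift ` Z) =
              (\<integral>\<^sup>+y\<in>Z. ennreal (exp (- \<phi> y + pressure X \<phi>)) \<partial>unstable_measure X \<phi> x))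
       \<and> (\<forall>x\<in>X. \<forall>Z. Z \<in> borel_subsets (W_s X x) \<and> inv shift ` Z \<subseteq> W_s X (inv shift x) \<longrightarrow>
            emeasure (stable_measure X \<phi> (inv shift x)) (inv shift ` Z) =
              (\<integral>\<^sup>+y\<in>Z. ennreal (exp (- \<phi> y + pressure X \<phi>)) \<partial>stable_measure X \<phi> x))"
proof (intro conjI ballI allI impI; elim conjE)
  fix x Z assume Z: "Z \<in> borel_subsets (W_u X x)" "shift ` Z \<subseteq> W_u X (shift x)"
  interpret leaf_transport X \<phi> "pressure X \<phi>" "cyl_plus X" "lists A" "W_u X x" "W_u X (shift x)"
    shift "inv shift" "\<lambda>v. x 0 # v" tl
    by (rule leaf_transport_unstable[OF assms])
  show "emeasure (unstable_measure X \<phi> (shift x)) (shift ` Z) =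
      (\<integral>\<^sup>+y\<in>Z. ennreal (exp (- \<phi> y + pressure X \<phi>)) \<partial>unstable_measure X \<phi> x)"
    by (rule emeasure_image[OF _ _ _ _ _ _ Z])
      (simp_all only: space_sets_leaf_measures emeasure_unstable_measure[OF assms(1)] unstable_value_eq)
next
  fix x Z assume Z: "Z \<in> borel_subsets (W_s X x)" "inv shift ` Z \<subseteq> W_s X (inv shift x)"
  interpret leaf_transport X \<phi> "pressure X \<phi>" "cyl_minus X" "lists A" "W_s X x" "W_s X (inv shift x)"
    "inv shift" shift "\<lambda>v. v @ [x 0]" butlast
    by (rule leaf_transport_stable[OF assms])
  show "emeasure (stable_measure X \<phi> (inv shift x)) (inv shift ` Z) =
      (\<integral>\<^sup>+y\<in>Z. ennreal (exp (- \<phi> y + pressure X \<phi>)) \<partial>stable_measure X \<phi> x)"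
    by (rule emeasure_image[OF _ _ _ _ _ _ Z])
      (simp_all only: space_sets_leaf_measures emeasure_stable_measure[OF assms(1)] stable_value_eq)
qed

end
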